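(* Let $X=\{(\alpha,\beta,\tau): -\tau<-\alpha<\beta<\tau,\ \alpha<\beta,\ Q(\alpha,\beta;\tau)=0\}$ (the parameter set of $\mathrm{oH}$ with $a<b$). For $0<\alpha<\tau$, the point $(\alpha,\alpha,\tau)$ (an $\mathrm{oP}$ surface) lies in the closure of $X$ if and only if $$\bar K(m_1)E(m_2)+m_2\bar E(m_1)K(m_2)=\bar K(m_1)K(m_2),\qquad m_1=\frac{\alpha^2+4}{\tau^2+4},\quad m_2=\frac{\alpha^2}{\tau^2}\frac{\tau^2+4}{\alpha^2+4},$$ where $0<m_1,m_2<1$.
   Context: For real $\alpha,\beta,\tau$ with $-\tau<-\alpha<\beta<\tau$ put $g_1(\zeta)=|\zeta+\alpha|^{1/2}|\zeta-\beta|^{-1/2}(\tau^2-\zeta^2)^{-1/2}(\zeta^2+4)^{-1/2}$ and $g_2(\zeta)=|\zeta+\alpha|^{-1/2}|\zeta-\beta|^{1/2}(\tau^2-\zeta^2)^{-1/2}(\zeta^2+4)^{-1/2}$, $I_1=\int_{-\tau}^{-\alpha}g_1$, $I_2=\int_{-\alpha}^{\beta}g_1$, $I_3=\int_{\beta}^{\tau}g_1$, $J_k$ likewise with $g_2$, and $Q(\alpha,\beta;\tau)=\frac{I_1+I_3}{I_2}-\frac{J_1+J_3}{J_2}$. Under $\alpha=a-1/a$, $\beta=b-1/b$, $\tau=t-1/t$ (with $a,b,t>0$, $1/t<1/a<b<t$), $Q=0$ is the period condition for the surfaces of the class $\mathcal O$, $\alpha=\beta$ corresponds to $\mathrm{oP}$,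 and $a<b$ iff $\alpha<\beta$. $K(m)=\int_0^{\pi/2}(1-m\sin^2\theta)^{-1/2}d\theta$, $E(m)=\int_0^{\pi/2}(1-m\sin^2\theta)^{1/2}d\theta$, $\bar K(m)=K(1-m)$, $\bar E(m)=E(1-m)$. *)

theory Defs
  imports "HOL-Analysis.Analysis"
begin

text \<open>Integrands. Note powr of 0 is 0 in Isabelle; the integrands are only modified on a
  null set (the endpoints), which does not affect the (improper, absolutely convergent) integrals.\<close>

definition g1 :: "real \<Rightarrow> real \<Rightarrow> real \<Rightarrow> real \<Rightarrow> real" where
  "g1 \<alpha> \<beta> \<tau> \<zeta> = \<bar>\<zeta> + \<alpha>\<bar> powr (1/2) * \<bar>\<zeta> - \<beta>\<bar> powr (-1/2)
      * (\<tau>\<^sup>2 - \<zeta>\<^sup>2) powr (-1/2) * (\<zeta>\<^sup>2 + 4) powr (-1/2)"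

definition g2 :: "real \<Rightarrow> real \<Rightarrow> real \<Rightarrow> real \<Rightarrow> real" where
  "g2 \<alpha> \<beta> \<tau> \<zeta> = \<bar>\<zeta> + \<alpha>\<bar> powr (-1/2) * \<bar>\<zeta> - \<beta>\<bar> powr (1/2)
      * (\<tau>\<^sup>2 - \<zeta>\<^sup>2) powr (-1/2) * (\<zeta>\<^sup>2 + 4) powr (-1/2)"

definition Qfun :: "real \<Rightarrow> real \<Rightarrow> real \<Rightarrow> real" where
  "Qfun \<alpha> \<beta> \<tau> =
     (let I1 = integral {-\<tau>..-\<alpha>} (g1 \<alpha> \<beta> \<tau>);
          I2 = integral {-\<alpha>..\<beta>} (g1 \<alpha> \<beta> \<tau>);
          I3 = integral {\<beta>..\<tau>} (g1 \<alpha> \<beta> \<tau>);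
          J1 = integral {-\<tau>..-\<alpha>} (g2 \<alpha> \<beta> \<tau>);
          J2 = integral {-\<alpha>..\<beta>} (g2 \<alpha> \<beta> \<tau>);
          J3 = integral {\<beta>..\<tau>} (g2 \<alpha> \<beta> \<tau>)
      in (I1 + I3) / I2 - (J1 + J3) / J2)"

definition ellK :: "real \<Rightarrow> real" where
  "ellK m = integral {0..pi/2} (\<lambda>\<theta>. 1 / sqrt (1 - m * (sin \<theta>)\<^sup>2))"

definition ellE :: "real \<Rightarrow> real" where
  "ellE m = integral {0..pi/2} (\<lambda>\<theta>. sqrt (1 - m * (sin \<theta>)\<^sup>2))"

definition ellKbar :: "real \<Rightarrow> real" where "ellKbar m = ellK (1 - m)"
definition ellEbar :: "real \<Rightarrow> real" where "ellEbar m = ellE (1 - m)"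

definition oH_params :: "(real \<times> real \<times> real) set" where
  "oH_params = {(\<alpha>, \<beta>, \<tau>). -\<tau> < -\<alpha> \<and> -\<alpha> < \<beta> \<and> \<beta> < \<tau> \<and> \<alpha> < \<beta> \<and> Qfun \<alpha> \<beta> \<tau> = 0}"

end

theory Submission
  imports Defs
begin

text \<open>
  The Moebius map $z \mapsto (z+\gamma)/(1+\gamma z/\tau^2)$ fixes $\pm\tau$ and, for suitable
  $k$ and $\gamma$, carries $[-k,k]$ to $[-\alpha,\beta]$, where $\gamma > 0$ iff $\alpha < \beta$.
  Up to constant factors that cancel in the quotients defining $Q$, it replaces $\alpha$ and
  $\beta$ by $k$ and $\zeta^2+4$ by $q(z) = (z+\gamma)^2 + 4(1+\gamma z/\tau^2)^2$, so the
  singularities become symmetric and all asymmetry sits in $q$. Since $q(-z)-q(z)$ is a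
  multiple of $\gamma z$, one factor $\gamma$ splits off from the numerator of $Q$, and for
  $\gamma > 0$ the equation $Q = 0$ becomes $H(k,\gamma,\tau) = 0$ with $H$ continuous also
  at $\gamma = 0$. There $H$ is a negative multiple of the elliptic expression, which gives
  necessity. For sufficiency, $(m_1,m_2)$ are coordinates on $0<\alpha<\tau$, and for fixed
  $m_2$ the elliptic expression is strictly increasing in $m_1$; so $H$ changes sign along
  this path, still does so after a small shift of $\beta$, and the intermediate value
  theorem yields zeros with $\alpha < \beta$.
\<close>

section \<open>Trigonometric substitutions\<close>

text \<open>Reflecting zeta turns \<open>g2\<close> into \<open>g1\<close> with alpha and beta
  exchanged, so Q(alpha, alpha; tau) = 0 throughout: the diagonal itself carries no information, and
  the criterion concerns the first-order term of Q in gamma. Differentiating Q directly is awkward,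
  because the inverse square roots sit at endpoints that move with the parameters. After the Moebius
  map and a trigonometric substitution all integrands are continuous on the fixed interval
  [0, pi/2], and continuity of H is continuity of parameter integrals over a compact interval.

  The moduli are cross ratios of branch points in w = z^2 at gamma = 0. The inner integral has
  branch points 0, k^2, -4, tau^2; the Moebius map taking 0, 1, infinity to the first three takes
  1/m2 to tau^2. The outer one has k^2, tau^2, -4, infinity; the map taking 0, 1, infinity to the
  first three takes 1/(1 - m1) to infinity, hence the complementary integrals in m1. Both maps are
  applied to the squared sine of the angle.\<close>

lemma absolute_integral_substitution_increasing:
  fixes F g g' h :: "real \<Rightarrow> real"
  assumes "a < b"
    and cont: "continuous_on {a..b} g"
    and der: "\<And>x. a < x \<Longrightarrow> x < b \<Longrightarrow> (g has_real_derivative g' x) (at x)"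
    and pos: "\<And>x. a < x \<Longrightarrow> x < b \<Longrightarrow> g' x > 0"
    and eq: "\<And>x. a < x \<Longrightarrow> x < b \<Longrightarrow> g' x * F (g x) = h x"
    and h: "h absolutely_integrable_on {a..b}"
  shows "F absolutely_integrable_on {g a..g b} \<and> integral {g a..g b} F = integral {a..b} h"
proof -
  have mono: "g x < g y" if "a \<le> x" "x < y" "y \<le> b" for x y
  proof (rule DERIV_pos_imp_increasing_open[OF that(2)])
    fix u assume "x < u" "u < y"
    then show "\<exists>d. (g has_real_derivative d) (at u) \<and> d > 0"
      using der[of u] pos[of u] that by auto
  next
    show "continuous_on {x..y} g"
      using cont by (rule continuous_on_subset) (use that in auto)
  qed
  \<comment> \<open>The transport takes place on open intervals, since the derivative and the
    identity with \<open>h\<close> are given only there and \<open>F\<close> may blow up at the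
    endpoints. The closed intervals return at the end, as they differ by a null set.\<close>
  have img: "g ` {a<..<b} = {g a<..<g b}"
  proof
    show "g ` {a<..<b} \<subseteq> {g a<..<g b}"
      using mono by auto
    show "{g a<..<g b} \<subseteq> g ` {a<..<b}"
    proof
      fix y assume y: "y \<in> {g a<..<g b}"
      then obtain x where "a \<le> x" "x \<le> b" "g x = y"
        using IVT'[of g a y b] \<open>a < b\<close> cont by auto
      then show "y \<in> g ` {a<..<b}"
        using y by (cases "x = a"; cases "x = b"; force)
    qed
  qed
  have inj: "inj_on g {a<..<b}"
    using mono by (intro linorder_inj_onI) (auto simp: less_imp_neq)
  have gab: "g a < g b" using mono \<open>a < b\<close> by auto
  have eq': "\<bar>g' x\<bar> * F (g x) = h x" if "x \<in> {a<..<b}" for x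
    using that eq[of x] pos[of x] by simp
  have "h absolutely_integrable_on {a<..<b}"
    using h absolutely_integrable_on_open_interval[of a b h] by simp
  then have 1: "(\<lambda>x. \<bar>g' x\<bar> * F (g x)) absolutely_integrable_on {a<..<b}"
    by (rule absolutely_integrable_spike[where S="{}"]) (use eq' in auto)
  have 2: "integral {a<..<b} (\<lambda>x. \<bar>g' x\<bar> * F (g x)) = integral {a..b} h"
    using integral_open_interval_real[of a b h] integral_cong[of "{a<..<b}", OF eq'] by simp
  have "F absolutely_integrable_on g ` {a<..<b} \<and> integral (g ` {a<..<b}) F = integral {a..b} h"
    using has_absolute_integral_change_of_variables_1'[of "{a<..<b}" g g' F "integral {a..b} h"]
      1 2 inj der by (simp add: has_field_derivative_at_within)
  then show ?thesis
    unfolding img using absolutely_integrable_on_open_interval[of "g a" "g b" F]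
      integral_open_interval_real[of "g a" "g b" F] by simp
qed

lemma sqrt_square_mult_divide:
  fixes a b c :: real
  assumes "0 \<le> a"
  shows "sqrt (a\<^sup>2 * b / c) = a * sqrt b / sqrt c"
  using assms by (simp add: real_sqrt_mult real_sqrt_divide)

text \<open>
  Substituting $z=$ \<open>zin k \<theta>\<close> turns $dz/\sqrt{(k^2-z^2)(\tau^2-z^2)(z^2+4)}$ on $[0,k]$ into
  $d\theta/\sqrt{N}$ with $N=$ \<open>Nin k \<tau> \<theta>\<close>, and $z=$ \<open>zout k \<tau> \<theta>\<close> turns
  $z dz/\sqrt{(z^2-k^2)(\tau^2-z^2)(z^2+4)}$ on $[k,\tau]$ into $d\theta/\sqrt{L}$ with
  $L=$ \<open>Lout k \<tau> \<theta>\<close>; \<open>inner_int\<close> and \<open>outer_int\<close> are the resulting functionals.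
\<close>

definition zin :: "real \<Rightarrow> real \<Rightarrow> real" where
  "zin k \<theta> = 2 * k * sin \<theta> / sqrt (4 + k\<^sup>2 * (cos \<theta>)\<^sup>2)"

definition Nin :: "real \<Rightarrow> real \<Rightarrow> real \<Rightarrow> real" where
  "Nin k \<tau> \<theta> = \<tau>\<^sup>2 * (k\<^sup>2 + 4) - k\<^sup>2 * (\<tau>\<^sup>2 + 4) * (sin \<theta>)\<^sup>2"

definition Lout :: "real \<Rightarrow> real \<Rightarrow> real \<Rightarrow> real" where
  "Lout k \<tau> \<theta> = (\<tau>\<^sup>2 + 4) * (cos \<theta>)\<^sup>2 + (k\<^sup>2 + 4) * (sin \<theta>)\<^sup>2"

definition zout :: "real \<Rightarrow> real \<Rightarrow> real \<Rightarrow> real" where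
  "zout k \<tau> \<theta> = sqrt ((k\<^sup>2 * (\<tau>\<^sup>2 + 4) * (cos \<theta>)\<^sup>2 + \<tau>\<^sup>2 * (k\<^sup>2 + 4) * (sin \<theta>)\<^sup>2) / Lout k \<tau> \<theta>)"

definition inner_int :: "real \<Rightarrow> real \<Rightarrow> (real \<Rightarrow> real) \<Rightarrow> real" where
  "inner_int k \<tau> f = integral {0..pi/2} (\<lambda>\<theta>. f (zin k \<theta>) / sqrt (Nin k \<tau> \<theta>))"

definition outer_int :: "real \<Rightarrow> real \<Rightarrow> (real \<Rightarrow> real) \<Rightarrow> real" where
  "outer_int k \<tau> f = integral {0..pi/2} (\<lambda>\<theta>. f (zout k \<tau> \<theta>) / sqrt (Lout k \<tau> \<theta>))"

section \<open>Algebra of the two trigonometric substitutions\<close>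

lemma Lout_pos: "Lout k \<tau> \<theta> > 0"
proof -
  have "Lout k \<tau> \<theta> = \<tau>\<^sup>2 * (cos \<theta>)\<^sup>2 + k\<^sup>2 * (sin \<theta>)\<^sup>2 + 4 * ((sin \<theta>)\<^sup>2 + (cos \<theta>)\<^sup>2)"
    by (simp only: Lout_def) algebra
  then show ?thesis by (simp add: add_nonneg_pos)
qed

text \<open>For 0 < k < tau both coefficients are positive, and sine and cosine never vanish
  together; this shows the positivity that the minus sign in the definition hides.\<close>

lemma Nin_alt: "Nin k \<tau> \<theta> = \<tau>\<^sup>2 * (k\<^sup>2 + 4) * (cos \<theta>)\<^sup>2 + 4 * (\<tau>\<^sup>2 - k\<^sup>2) * (sin \<theta>)\<^sup>2"
proof -
  have "(cos \<theta>)\<^sup>2 = 1 - (sin \<theta>)\<^sup>2" by (simp add: cos_squared_eq)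
  then show ?thesis unfolding Nin_def by algebra
qed

lemma Nin_pos:
  assumes "0 < k" "k < \<tau>"
  shows "Nin k \<tau> \<theta> > 0"
proof -
  have kt: "k\<^sup>2 < \<tau>\<^sup>2" using assms by (simp add: power_strict_mono)
  have t: "0 < \<tau>" using assms by simp
  show ?thesis
  proof (cases "cos \<theta> = 0")
    case True
    then have "(sin \<theta>)\<^sup>2 = 1" using sin_squared_eq[of \<theta>] by simp
    then show ?thesis using kt True by (simp add: Nin_alt)
  next
    case False
    then have "\<tau>\<^sup>2 * (k\<^sup>2 + 4) * (cos \<theta>)\<^sup>2 > 0" using t
      by (intro mult_pos_pos) (auto simp: add_nonneg_pos)
    moreover have "4 * (\<tau>\<^sup>2 - k\<^sup>2) * (sin \<theta>)\<^sup>2 \<ge> 0" using kt by auto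
    ultimately show ?thesis unfolding Nin_alt by linarith
  qed
qed

lemma zin_den_pos: "4 + k\<^sup>2 * (cos \<theta>)\<^sup>2 > (0::real)"
  by (simp add: add_pos_nonneg)

lemma zin_sq:
  "(zin k \<theta>)\<^sup>2 = 4 * k\<^sup>2 * (sin \<theta>)\<^sup>2 / (4 + k\<^sup>2 * (cos \<theta>)\<^sup>2)"
  using zin_den_pos[of k \<theta>] by (simp add: zin_def power_divide power_mult_distrib)

text \<open>By \<open>zin_sq\<close>, z^2 is a Moebius function of the squared sine taking 0, 1,
  infinity to 0, k^2, -4. Hence its difference from any constant is affine in the squared sine over
  the common denominator \<open>l\<close>, and for -4, the image of infinity, the numerator is
  constant.\<close>

lemma zin_identities:
  fixes k \<tau> \<theta> :: real
  defines "l \<equiv> 4 + k\<^sup>2 * (cos \<theta>)\<^sup>2"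
  shows "k\<^sup>2 - (zin k \<theta>)\<^sup>2 = k\<^sup>2 * (k\<^sup>2 + 4) * (cos \<theta>)\<^sup>2 / l"
    and "\<tau>\<^sup>2 - (zin k \<theta>)\<^sup>2 = Nin k \<tau> \<theta> / l"
    and "(zin k \<theta>)\<^sup>2 + 4 = 4 * (k\<^sup>2 + 4) / l"
proof -
  have l: "l > 0" using zin_den_pos by (simp add: l_def)
  have s: "(sin \<theta>)\<^sup>2 = 1 - (cos \<theta>)\<^sup>2" by (simp add: sin_squared_eq)
  show "k\<^sup>2 - (zin k \<theta>)\<^sup>2 = k\<^sup>2 * (k\<^sup>2 + 4) * (cos \<theta>)\<^sup>2 / l"
    unfolding zin_sq l_def[symmetric] using l
    by (simp add: field_simps) (simp add: l_def s algebra_simps)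
  show "\<tau>\<^sup>2 - (zin k \<theta>)\<^sup>2 = Nin k \<tau> \<theta> / l"
    unfolding zin_sq l_def[symmetric] using l
    by (simp add: field_simps) (simp add: l_def Nin_def s algebra_simps)
  show "(zin k \<theta>)\<^sup>2 + 4 = 4 * (k\<^sup>2 + 4) / l"
    unfolding zin_sq l_def[symmetric] using l
    by (simp add: field_simps) (simp add: l_def s algebra_simps)
qed

lemma zout_sq:
  "(zout k \<tau> \<theta>)\<^sup>2 =
    (k\<^sup>2 * (\<tau>\<^sup>2 + 4) * (cos \<theta>)\<^sup>2 + \<tau>\<^sup>2 * (k\<^sup>2 + 4) * (sin \<theta>)\<^sup>2) / Lout k \<tau> \<theta>"
  using Lout_pos[of k \<tau> \<theta>] by (simp add: zout_def)

text \<open>Same mechanism as for \<open>zin\<close>, now with 0, 1, infinity taken to k^2, tau^2,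
  -4 and common denominator \<open>Lout\<close>.\<close>

lemma zout_identities:
  shows "(zout k \<tau> \<theta>)\<^sup>2 - k\<^sup>2 = (k\<^sup>2 + 4) * (\<tau>\<^sup>2 - k\<^sup>2) * (sin \<theta>)\<^sup>2 / Lout k \<tau> \<theta>"
    and "\<tau>\<^sup>2 - (zout k \<tau> \<theta>)\<^sup>2 = (\<tau>\<^sup>2 + 4) * (\<tau>\<^sup>2 - k\<^sup>2) * (cos \<theta>)\<^sup>2 / Lout k \<tau> \<theta>"
    and "(zout k \<tau> \<theta>)\<^sup>2 + 4 = (k\<^sup>2 + 4) * (\<tau>\<^sup>2 + 4) / Lout k \<tau> \<theta>"
proof -
  have s: "(cos \<theta>)\<^sup>2 = 1 - (sin \<theta>)\<^sup>2" by (simp add: cos_squared_eq)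
  note L = Lout_pos[of k \<tau> \<theta>]
  show "(zout k \<tau> \<theta>)\<^sup>2 - k\<^sup>2 = (k\<^sup>2 + 4) * (\<tau>\<^sup>2 - k\<^sup>2) * (sin \<theta>)\<^sup>2 / Lout k \<tau> \<theta>"
    unfolding zout_sq using L
    by (simp add: field_simps) (simp add: Lout_def algebra_simps)
  show "\<tau>\<^sup>2 - (zout k \<tau> \<theta>)\<^sup>2 = (\<tau>\<^sup>2 + 4) * (\<tau>\<^sup>2 - k\<^sup>2) * (cos \<theta>)\<^sup>2 / Lout k \<tau> \<theta>"
    unfolding zout_sq using L
    by (simp add: field_simps) (simp add: Lout_def algebra_simps)
  show "(zout k \<tau> \<theta>)\<^sup>2 + 4 = (k\<^sup>2 + 4) * (\<tau>\<^sup>2 + 4) / Lout k \<tau> \<theta>"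
    unfolding zout_sq using L
    by (simp add: field_simps) (simp add: Lout_def s algebra_simps)
qed

lemma zout_bounds:
  assumes "0 < k" "k < \<tau>"
  shows "k \<le> zout k \<tau> \<theta>" "zout k \<tau> \<theta> \<le> \<tau>" "0 < zout k \<tau> \<theta>"
proof -
  have kt: "k\<^sup>2 < \<tau>\<^sup>2" using assms by (simp add: power_strict_mono)
  have z0: "zout k \<tau> \<theta> \<ge> 0"
    using less_imp_le[OF Lout_pos[of k \<tau> \<theta>]] by (simp add: zout_def)
  have "(zout k \<tau> \<theta>)\<^sup>2 - k\<^sup>2 \<ge> 0" "\<tau>\<^sup>2 - (zout k \<tau> \<theta>)\<^sup>2 \<ge> 0"
    unfolding zout_identities using kt less_imp_le[OF Lout_pos[of k \<tau> \<theta>]] by auto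
  then show "k \<le> zout k \<tau> \<theta>" "zout k \<tau> \<theta> \<le> \<tau>"
    using z0 assms power2_le_imp_le[of k "zout k \<tau> \<theta>"] power2_le_imp_le[of "zout k \<tau> \<theta>" \<tau>] by simp_all
  then show "0 < zout k \<tau> \<theta>" using assms by simp
qed

lemma zin_bounds:
  assumes "0 < k" "0 \<le> \<theta>" "\<theta> \<le> pi/2"
  shows "0 \<le> zin k \<theta>" "zin k \<theta> \<le> k"
proof -
  show "0 \<le> zin k \<theta>"
    unfolding zin_def using assms sin_ge_zero[of \<theta>] zin_den_pos[of k \<theta>]
    by (intro divide_nonneg_nonneg mult_nonneg_nonneg) auto
  have "k\<^sup>2 - (zin k \<theta>)\<^sup>2 \<ge> 0"
    unfolding zin_identities using zin_den_pos[of k \<theta>] by auto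
  then show "zin k \<theta> \<le> k"
    using assms power2_le_imp_le[of "zin k \<theta>" k] by simp
qed

section \<open>Joint continuity in the angle and the parameters\<close>

lemma continuous_on_zin [continuous_intros]:
  fixes k and \<theta> :: "'a::t2_space \<Rightarrow> real"
  assumes "continuous_on A k" "continuous_on A \<theta>"
  shows "continuous_on A (\<lambda>x. zin (k x) (\<theta> x))"
proof -
  have "sqrt (4 + (k x)\<^sup>2 * (cos (\<theta> x))\<^sup>2) \<noteq> 0" for x
    using zin_den_pos[of "k x" "\<theta> x"] by simp
  then show ?thesis
    unfolding zin_def by (intro continuous_intros assms) auto
qed

lemma continuous_on_Nin [continuous_intros]:
  fixes k and \<tau> and \<theta> :: "'a::t2_space \<Rightarrow> real"
  assumes "continuous_on A k" "continuous_on A \<tau>" "continuous_on A \<theta>"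
  shows "continuous_on A (\<lambda>x. Nin (k x) (\<tau> x) (\<theta> x))"
  unfolding Nin_def by (intro continuous_intros assms)

lemma continuous_on_Lout [continuous_intros]:
  fixes k and \<tau> and \<theta> :: "'a::t2_space \<Rightarrow> real"
  assumes "continuous_on A k" "continuous_on A \<tau>" "continuous_on A \<theta>"
  shows "continuous_on A (\<lambda>x. Lout (k x) (\<tau> x) (\<theta> x))"
  unfolding Lout_def by (intro continuous_intros assms)

lemma continuous_on_zout [continuous_intros]:
  fixes k and \<tau> and \<theta> :: "'a::t2_space \<Rightarrow> real"
  assumes "continuous_on A k" "continuous_on A \<tau>" "continuous_on A \<theta>"
  shows "continuous_on A (\<lambda>x. zout (k x) (\<tau> x) (\<theta> x))"
proof -
  have "Lout (k x) (\<tau> x) (\<theta> x) \<noteq> 0" for x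
    using Lout_pos[of "k x" "\<tau> x" "\<theta> x"] by simp
  then show ?thesis
    unfolding zout_def by (intro continuous_intros assms) auto
qed

lemma continuous_inner_integrand:
  assumes "0 < k" "k < \<tau>" "continuous_on {0..k} f"
  shows "continuous_on {0..pi/2} (\<lambda>\<theta>. f (zin k \<theta>) / sqrt (Nin k \<tau> \<theta>))"
proof -
  have "continuous_on {0..pi/2} (\<lambda>\<theta>. f (zin k \<theta>))"
    by (rule continuous_on_compose2[OF assms(3)])
      (use assms zin_bounds in \<open>auto intro: continuous_on_zin continuous_on_id continuous_on_const\<close>)
  moreover have "sqrt (Nin k \<tau> \<theta>) \<noteq> 0" for \<theta>
    using Nin_pos[OF assms(1,2), of \<theta>] by simp
  ultimately show ?thesis
    by (intro continuous_on_divide continuous_on_real_sqrt continuous_on_Nin continuous_on_const continuous_on_id) auto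
qed

lemma continuous_outer_integrand:
  assumes "0 < k" "k < \<tau>" "continuous_on {k..\<tau>} f"
  shows "continuous_on {0..pi/2} (\<lambda>\<theta>. f (zout k \<tau> \<theta>) / sqrt (Lout k \<tau> \<theta>))"
proof -
  have "continuous_on {0..pi/2} (\<lambda>\<theta>. f (zout k \<tau> \<theta>))"
    by (rule continuous_on_compose2[OF assms(3)])
      (use assms zout_bounds in \<open>auto intro: continuous_on_zout continuous_on_id continuous_on_const\<close>)
  moreover have "sqrt (Lout k \<tau> \<theta>) \<noteq> 0" for \<theta>
    using Lout_pos[of k \<tau> \<theta>] by simp
  ultimately show ?thesis
    by (intro continuous_on_divide continuous_on_real_sqrt continuous_on_Lout continuous_on_const continuous_on_id) auto
qed

text \<open>\<open>f\<close> holds the part of the integrand that stays continuous on [0, k]. The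
  singularity at k is cancelled by the derivative of \<open>zin\<close>, so integrability of
  \<open>F\<close> comes out as a conclusion.\<close>

lemma inner_int_substitution:
  assumes k: "0 < k" "k < \<tau>" and f: "continuous_on {0..k} f"
    and F: "\<And>z. 0 < z \<Longrightarrow> z < k \<Longrightarrow>
      F z = f z / sqrt ((k\<^sup>2 - z\<^sup>2) * (\<tau>\<^sup>2 - z\<^sup>2) * (z\<^sup>2 + 4))"
  shows "F absolutely_integrable_on {0..k} \<and> integral {0..k} F = inner_int k \<tau> f"
proof -
  define g' where "g' \<theta> = 2 * k * cos \<theta> * (k\<^sup>2 + 4) / (sqrt (4 + k\<^sup>2 * (cos \<theta>)\<^sup>2))^3" for \<theta>
  have "F absolutely_integrable_on {zin k 0..zin k (pi/2)} \<and>
     integral {zin k 0..zin k (pi/2)} F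
       = integral {0..pi/2} (\<lambda>\<theta>. f (zin k \<theta>) / sqrt (Nin k \<tau> \<theta>))"
  proof (rule absolute_integral_substitution_increasing[where g' = g'])
    show "(0::real) < pi/2" by simp
    show "continuous_on {0..pi/2} (zin k)"
      by (intro continuous_intros)
    show "(\<lambda>\<theta>. f (zin k \<theta>) / sqrt (Nin k \<tau> \<theta>)) absolutely_integrable_on {0..pi/2}"
      by (intro absolutely_integrable_continuous_real continuous_inner_integrand assms)
    fix \<theta> :: real assume \<theta>: "0 < \<theta>" "\<theta> < pi/2"
    define l where "l = 4 + k\<^sup>2 * (cos \<theta>)\<^sup>2"
    have l: "l > 0" using zin_den_pos by (simp add: l_def)
    have c: "cos \<theta> > 0" and s: "sin \<theta> > 0"
      using \<theta> by (auto intro: cos_gt_zero sin_gt_zero)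
    have s2: "(sin \<theta>)\<^sup>2 = 1 - (cos \<theta>)\<^sup>2" by (simp add: sin_squared_eq)
    show "g' \<theta> > 0"
      using c k l by (auto simp: g'_def l_def[symmetric] intro!: divide_pos_pos mult_pos_pos add_nonneg_pos)
    have "(zin k has_real_derivative
        (2 * k * cos \<theta> * sqrt l - 2 * k * sin \<theta> * (- (k\<^sup>2 * (2 * cos \<theta> * sin \<theta>)) / (2 * sqrt l))) / l) (at \<theta>)"
      unfolding zin_def[abs_def] l_def using l
      by (auto intro!: derivative_eq_intros simp: l_def field_simps)
    also have "(2 * k * cos \<theta> * sqrt l - 2 * k * sin \<theta> * (- (k\<^sup>2 * (2 * cos \<theta> * sin \<theta>)) / (2 * sqrt l))) / l
      = 2 * k * cos \<theta> * ((sqrt l)\<^sup>2 + k\<^sup>2 * (sin \<theta>)\<^sup>2) / (sqrt l * l)"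
      using l by (simp add: field_simps power2_eq_square)
    also have "(sqrt l)\<^sup>2 + k\<^sup>2 * (sin \<theta>)\<^sup>2 = k\<^sup>2 + 4"
      using l by (simp add: l_def s2 algebra_simps)
    also have "sqrt l * l = (sqrt l)^3"
      using l by (simp add: power3_eq_cube)
    finally show "(zin k has_real_derivative g' \<theta>) (at \<theta>)"
      by (simp add: g'_def l_def)
    have z: "0 < zin k \<theta>" "zin k \<theta> < k"
    proof -
      show "0 < zin k \<theta>" using k s l by (simp add: zin_def l_def[symmetric])
      have "k\<^sup>2 - (zin k \<theta>)\<^sup>2 > 0"
        unfolding zin_identities l_def[symmetric] using k c l
        by (auto intro!: divide_pos_pos mult_pos_pos add_nonneg_pos)
      then show "zin k \<theta> < k" using k power2_less_imp_less[of "zin k \<theta>" k] by simp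
    qed
    \<comment> \<open>The product of the three factors is a perfect square times \<open>Nin\<close>
      over l^3, and its square part over l^3 is exactly the square of \<open>g'\<close>. The
      derivative therefore cancels and leaves 1 / sqrt \<open>Nin\<close>.\<close>
    have eq: "(k\<^sup>2 - (zin k \<theta>)\<^sup>2) * (\<tau>\<^sup>2 - (zin k \<theta>)\<^sup>2) * ((zin k \<theta>)\<^sup>2 + 4)
      = (2 * k * cos \<theta> * (k\<^sup>2 + 4))\<^sup>2 * Nin k \<tau> \<theta> / l^3"
      unfolding zin_identities l_def[symmetric]
      by (simp add: power2_eq_square power3_eq_cube)
    have "sqrt ((k\<^sup>2 - (zin k \<theta>)\<^sup>2) * (\<tau>\<^sup>2 - (zin k \<theta>)\<^sup>2) * ((zin k \<theta>)\<^sup>2 + 4))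
      = 2 * k * cos \<theta> * (k\<^sup>2 + 4) * sqrt (Nin k \<tau> \<theta>) / (sqrt l)^3"
      unfolding eq real_sqrt_power[symmetric]
      by (rule sqrt_square_mult_divide) (use k c in auto)
    also have "\<dots> = g' \<theta> * sqrt (Nin k \<tau> \<theta>)" by (simp add: g'_def l_def)
    finally show "g' \<theta> * F (zin k \<theta>) = f (zin k \<theta>) / sqrt (Nin k \<tau> \<theta>)"
      using \<open>g' \<theta> > 0\<close> z by (simp add: F)
  qed
  moreover have "zin k 0 = 0" "zin k (pi/2) = k" using k by (auto simp: zin_def)
  ultimately show ?thesis by (simp add: inner_int_def)
qed

text \<open>With w = z^2 the factor z absorbs the differential, z dz = dw / 2, so 0 is no branch
  point as it was in the inner integral. Infinity takes its place, and its preimage is the zero of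
  \<open>Lout\<close> as a function of the squared sine.\<close>

lemma outer_int_substitution:
  assumes k: "0 < k" "k < \<tau>" and f: "continuous_on {k..\<tau>} f"
    and F: "\<And>z. k < z \<Longrightarrow> z < \<tau> \<Longrightarrow>
      F z = z * f z / sqrt ((z\<^sup>2 - k\<^sup>2) * (\<tau>\<^sup>2 - z\<^sup>2) * (z\<^sup>2 + 4))"
  shows "F absolutely_integrable_on {k..\<tau>} \<and> integral {k..\<tau>} F = outer_int k \<tau> f"
proof -
  define g' where "g' \<theta> = (k\<^sup>2 + 4) * (\<tau>\<^sup>2 + 4) * (\<tau>\<^sup>2 - k\<^sup>2) * (sin \<theta> * cos \<theta>)
      / ((Lout k \<tau> \<theta>)\<^sup>2 * zout k \<tau> \<theta>)" for \<theta>
  have kt: "k\<^sup>2 < \<tau>\<^sup>2" using k by (simp add: power_strict_mono)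
  have "F absolutely_integrable_on {zout k \<tau> 0..zout k \<tau> (pi/2)} \<and>
     integral {zout k \<tau> 0..zout k \<tau> (pi/2)} F
       = integral {0..pi/2} (\<lambda>\<theta>. f (zout k \<tau> \<theta>) / sqrt (Lout k \<tau> \<theta>))"
  proof (rule absolute_integral_substitution_increasing[where g' = g'])
    show "(0::real) < pi/2" by simp
    show "continuous_on {0..pi/2} (zout k \<tau>)"
      by (intro continuous_intros)
    show "(\<lambda>\<theta>. f (zout k \<tau> \<theta>) / sqrt (Lout k \<tau> \<theta>)) absolutely_integrable_on {0..pi/2}"
      by (intro absolutely_integrable_continuous_real continuous_outer_integrand assms)
    fix \<theta> :: real assume \<theta>: "0 < \<theta>" "\<theta> < pi/2"
    have c: "cos \<theta> > 0" and s: "sin \<theta> > 0"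
      using \<theta> by (auto intro: cos_gt_zero sin_gt_zero)
    have c2: "(cos \<theta>)\<^sup>2 = 1 - (sin \<theta>)\<^sup>2" by (simp add: cos_squared_eq)
    note L = Lout_pos[of k \<tau> \<theta>] and z0 = zout_bounds(3)[OF k, of \<theta>]
    show g'pos: "g' \<theta> > 0"
      using c s L z0 kt by (auto simp: g'_def intro!: divide_pos_pos mult_pos_pos add_nonneg_pos)
    define n where "n \<theta> = k\<^sup>2 * (\<tau>\<^sup>2 + 4) * (cos \<theta>)\<^sup>2 + \<tau>\<^sup>2 * (k\<^sup>2 + 4) * (sin \<theta>)\<^sup>2" for \<theta>
    define n' where "n' = 2 * sin \<theta> * cos \<theta> * (\<tau>\<^sup>2 * (k\<^sup>2 + 4) - k\<^sup>2 * (\<tau>\<^sup>2 + 4))"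
    define L' where "L' = 2 * sin \<theta> * cos \<theta> * ((k\<^sup>2 + 4) - (\<tau>\<^sup>2 + 4))"
    have dn: "(n has_real_derivative n') (at \<theta>)"
      unfolding n_def n'_def by (auto intro!: derivative_eq_intros simp: algebra_simps)
    have dL: "(Lout k \<tau> has_real_derivative L') (at \<theta>)"
      unfolding Lout_def[abs_def] L'_def by (auto intro!: derivative_eq_intros simp: algebra_simps)
    have zn: "zout k \<tau> = (\<lambda>\<theta>. sqrt (n \<theta> / Lout k \<tau> \<theta>))"
      by (simp add: zout_def n_def fun_eq_iff)
    have nL: "n \<theta> / Lout k \<tau> \<theta> > 0" using z0 by (simp add: zn)
    have "((\<lambda>\<theta>. n \<theta> / Lout k \<tau> \<theta>) has_real_derivative
       (n' * Lout k \<tau> \<theta> - n \<theta> * L') / (Lout k \<tau> \<theta> * Lout k \<tau> \<theta>)) (at \<theta>)"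
      by (rule DERIV_divide[OF dn dL]) (use L in auto)
    from DERIV_chain2[OF DERIV_real_sqrt[OF nL] this]
    have "(zout k \<tau> has_real_derivative
       ((n' * Lout k \<tau> \<theta> - n \<theta> * L') / (Lout k \<tau> \<theta>)\<^sup>2) / (2 * zout k \<tau> \<theta>)) (at \<theta>)"
      unfolding zn by (simp add: power2_eq_square inverse_eq_divide mult.commute)
    \<comment> \<open>The last factor is the determinant of the Moebius map from the squared sine to
      z^2, which is why everything else cancels in the quotient rule.\<close>
    also have "n' * Lout k \<tau> \<theta> - n \<theta> * L'
        = 2 * sin \<theta> * cos \<theta> * ((k\<^sup>2 + 4) * (\<tau>\<^sup>2 + 4) * (\<tau>\<^sup>2 - k\<^sup>2))"
      by (simp only: n'_def L'_def n_def Lout_def c2) algebra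
    also have "(2 * sin \<theta> * cos \<theta> * ((k\<^sup>2 + 4) * (\<tau>\<^sup>2 + 4) * (\<tau>\<^sup>2 - k\<^sup>2)) / (Lout k \<tau> \<theta>)\<^sup>2)
        / (2 * zout k \<tau> \<theta>) = g' \<theta>"
      using L z0 by (simp add: g'_def)
    finally show "(zout k \<tau> has_real_derivative g' \<theta>) (at \<theta>)" .
    have z: "k < zout k \<tau> \<theta>" "zout k \<tau> \<theta> < \<tau>"
    proof -
      have "(zout k \<tau> \<theta>)\<^sup>2 - k\<^sup>2 > 0" "\<tau>\<^sup>2 - (zout k \<tau> \<theta>)\<^sup>2 > 0"
        unfolding zout_identities using kt L c s
        by (auto intro!: divide_pos_pos mult_pos_pos add_nonneg_pos)
      then show "k < zout k \<tau> \<theta>" "zout k \<tau> \<theta> < \<tau>"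
        using z0 k power2_less_imp_less[of k "zout k \<tau> \<theta>"] power2_less_imp_less[of "zout k \<tau> \<theta>" \<tau>]
        by simp_all
    qed
    have eq: "((zout k \<tau> \<theta>)\<^sup>2 - k\<^sup>2) * (\<tau>\<^sup>2 - (zout k \<tau> \<theta>)\<^sup>2) * ((zout k \<tau> \<theta>)\<^sup>2 + 4)
      = ((k\<^sup>2 + 4) * (\<tau>\<^sup>2 + 4) * (\<tau>\<^sup>2 - k\<^sup>2) * (sin \<theta> * cos \<theta>))\<^sup>2 * 1 / (Lout k \<tau> \<theta>)^3"
      unfolding zout_identities
      by (simp add: power2_eq_square power3_eq_cube)
    have "sqrt (((zout k \<tau> \<theta>)\<^sup>2 - k\<^sup>2) * (\<tau>\<^sup>2 - (zout k \<tau> \<theta>)\<^sup>2) * ((zout k \<tau> \<theta>)\<^sup>2 + 4))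
      = (k\<^sup>2 + 4) * (\<tau>\<^sup>2 + 4) * (\<tau>\<^sup>2 - k\<^sup>2) * (sin \<theta> * cos \<theta>) * sqrt 1 / sqrt ((Lout k \<tau> \<theta>)^3)"
      unfolding eq by (rule sqrt_square_mult_divide) (use kt c s in \<open>auto intro!: mult_nonneg_nonneg\<close>)
    also have "\<dots> = (k\<^sup>2 + 4) * (\<tau>\<^sup>2 + 4) * (\<tau>\<^sup>2 - k\<^sup>2) * (sin \<theta> * cos \<theta>) * sqrt (Lout k \<tau> \<theta>) / (Lout k \<tau> \<theta>)\<^sup>2"
    proof -
      have "(Lout k \<tau> \<theta>)\<^sup>2 = sqrt ((Lout k \<tau> \<theta>)^3) * sqrt (Lout k \<tau> \<theta>)"
        using L by (simp add: real_sqrt_mult power3_eq_cube power2_eq_square)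
      then show ?thesis using L by simp
    qed
    also have "\<dots> = g' \<theta> * zout k \<tau> \<theta> * sqrt (Lout k \<tau> \<theta>)" using z0 by (simp add: g'_def)
    finally show "g' \<theta> * F (zout k \<tau> \<theta>) = f (zout k \<tau> \<theta>) / sqrt (Lout k \<tau> \<theta>)"
      using g'pos z z0 by (simp add: F)
  qed
  moreover have "zout k \<tau> 0 = k" "zout k \<tau> (pi/2) = \<tau>"
    using k by (auto simp: zout_def Lout_def real_sqrt_mult real_sqrt_divide add_nonneg_eq_0_iff)
  ultimately show ?thesis by (simp add: outer_int_def)
qed

section \<open>The Moebius substitution\<close>

definition mob :: "real \<Rightarrow> real \<Rightarrow> real \<Rightarrow> real" where
  "mob \<gamma> \<tau> z = (z + \<gamma>) / (1 + \<gamma> * z / \<tau>\<^sup>2)"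

definition qf :: "real \<Rightarrow> real \<Rightarrow> real \<Rightarrow> real" where
  "qf \<gamma> \<tau> z = (z + \<gamma>)\<^sup>2 + 4 * (1 + \<gamma> * z / \<tau>\<^sup>2)\<^sup>2"

definition mob_integrand :: "real \<Rightarrow> real \<Rightarrow> real \<Rightarrow> real \<Rightarrow> real" where
  "mob_integrand k \<gamma> \<tau> z = sqrt \<bar>z + k\<bar> / (sqrt \<bar>z - k\<bar> * sqrt (\<tau>\<^sup>2 - z\<^sup>2) * sqrt (qf \<gamma> \<tau> z))"

text \<open>The factor picked up by \<open>g1\<close>: the quotient comes from the images of k and
  -k under the Moebius map, and the last root is what remains of the derivative after the other
  factors are taken out. It is common to all three integrals, so only its positivity
  matters.\<close>

definition mob_const :: "real \<Rightarrow> real \<Rightarrow> real \<Rightarrow> real" where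
  "mob_const k \<gamma> \<tau> = sqrt ((1 + \<gamma> * k / \<tau>\<^sup>2) / (1 - \<gamma> * k / \<tau>\<^sup>2)) * sqrt (1 - \<gamma>\<^sup>2 / \<tau>\<^sup>2)"

lemma mob_den_pos:
  fixes \<gamma> \<tau> z :: real
  assumes "0 < \<tau>" "\<bar>\<gamma>\<bar> < \<tau>" "\<bar>z\<bar> \<le> \<tau>"
  shows "1 + \<gamma> * z / \<tau>\<^sup>2 > 0"
proof -
  have "\<bar>\<gamma> * z\<bar> \<le> \<bar>\<gamma>\<bar> * \<tau>" unfolding abs_mult using assms by (intro mult_left_mono) auto
  also have "\<dots> < \<tau> * \<tau>" using assms by (intro mult_strict_right_mono)
  finally have "\<gamma> * z > - (\<tau>\<^sup>2)" by (simp add: power2_eq_square)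
  then show ?thesis using assms by (simp add: field_simps)
qed

lemma qf_pos:
  assumes "0 < \<tau>" "\<bar>\<gamma>\<bar> < \<tau>"
  shows "qf \<gamma> \<tau> z > 0"
proof (cases "z = - \<gamma>")
  case True
  then have "1 + \<gamma> * z / \<tau>\<^sup>2 > 0" using assms by (intro mob_den_pos) auto
  then show ?thesis by (simp add: qf_def add_nonneg_pos)
next
  case False
  then have "(z + \<gamma>)\<^sup>2 > 0" by simp
  then show ?thesis by (simp add: qf_def add_pos_nonneg)
qed

lemma mob_const_pos:
  assumes "0 < k" "k < \<tau>" "\<bar>\<gamma>\<bar> < \<tau>"
  shows "mob_const k \<gamma> \<tau> > 0"
  using mob_den_pos[of \<tau> \<gamma> k] mob_den_pos[of \<tau> \<gamma> "-k"] mob_den_pos[of \<tau> \<gamma> "-\<gamma>"] assms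
  by (simp add: mob_const_def power2_eq_square)

text \<open>The equation also holds at the zeros of the factors, since
  \<open>0 powr (-1/2) = 0\<close> and \<open>1 / sqrt 0 = 0\<close> agree as default values. The
  hypothesis keeps the base of the third power nonnegative.\<close>

lemma g1_sqrt:
  assumes "\<zeta>\<^sup>2 \<le> \<tau>\<^sup>2"
  shows "g1 \<alpha> \<beta> \<tau> \<zeta> = sqrt \<bar>\<zeta> + \<alpha>\<bar> / (sqrt \<bar>\<zeta> - \<beta>\<bar> * sqrt (\<tau>\<^sup>2 - \<zeta>\<^sup>2) * sqrt (\<zeta>\<^sup>2 + 4))"
proof -
  have "x powr (-1/2) = 1 / sqrt x" if "x \<ge> 0" for x :: real
    using that powr_minus_divide[of x "1/2"] by (simp add: powr_half_sqrt)
  then show ?thesis using assms by (simp add: g1_def powr_half_sqrt)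
qed

text \<open>A Moebius map sends a difference of two points to that difference times the constant
  \<open>c\<close>, divided by the two denominators. In \<open>g1\<close> the denominators at z
  collect to d^2, which the derivative c / d^2 cancels; only constants remain.\<close>

lemma g1_mob:
  assumes k: "0 < k" "k < \<tau>" and \<gamma>: "\<bar>\<gamma>\<bar> < \<tau>" and z: "\<bar>z\<bar> < \<tau>"
  shows "(1 - \<gamma>\<^sup>2 / \<tau>\<^sup>2) / (1 + \<gamma> * z / \<tau>\<^sup>2)\<^sup>2 * g1 (- mob \<gamma> \<tau> (- k)) (mob \<gamma> \<tau> k) \<tau> (mob \<gamma> \<tau> z)
    = mob_const k \<gamma> \<tau> * mob_integrand k \<gamma> \<tau> z"
proof -
  define c where "c = 1 - \<gamma>\<^sup>2 / \<tau>\<^sup>2"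
  define d where "d = 1 + \<gamma> * z / \<tau>\<^sup>2"
  define e where "e = 1 + \<gamma> * k / \<tau>\<^sup>2"
  define e' where "e' = 1 - \<gamma> * k / \<tau>\<^sup>2"
  have \<tau>: "\<tau> > 0" using k by simp
  have c: "c > 0" and d: "d > 0" and e: "e > 0" and e': "e' > 0"
    using mob_den_pos[of \<tau> \<gamma> k] mob_den_pos[of \<tau> \<gamma> "-k"] mob_den_pos[of \<tau> \<gamma> "-\<gamma>"]
      mob_den_pos[of \<tau> \<gamma> z] k \<gamma> z by (auto simp: c_def d_def e_def e'_def power2_eq_square)
  have mz: "mob \<gamma> \<tau> z = (z + \<gamma>) / d" and mk: "mob \<gamma> \<tau> k = (k + \<gamma>) / e"
    and mk': "mob \<gamma> \<tau> (- k) = (\<gamma> - k) / e'"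
    by (auto simp: mob_def d_def e_def e'_def)
  have 1: "mob \<gamma> \<tau> z + - mob \<gamma> \<tau> (- k) = (z + k) * c / (d * e')"
  proof -
    have "(z + \<gamma>) * e' - (\<gamma> - k) * d = (z + k) * c"
      using \<tau> by (simp add: c_def d_def e'_def field_simps power2_eq_square)
    then show ?thesis unfolding mz mk' using d e' by (simp add: divide_simps)
  qed
  have 2: "mob \<gamma> \<tau> z - mob \<gamma> \<tau> k = (z - k) * c / (d * e)"
  proof -
    have "(z + \<gamma>) * e - (k + \<gamma>) * d = (z - k) * c"
      using \<tau> by (simp add: c_def d_def e_def field_simps power2_eq_square)
    then show ?thesis unfolding mz mk using d e by (simp add: divide_simps)
  qed
  have 3: "\<tau>\<^sup>2 - (mob \<gamma> \<tau> z)\<^sup>2 = (\<tau>\<^sup>2 - z\<^sup>2) * c / d\<^sup>2"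
  proof -
    have "\<tau>\<^sup>2 * d\<^sup>2 - (z + \<gamma>)\<^sup>2 = (\<tau>\<^sup>2 - z\<^sup>2) * c"
      using \<tau> by (simp add: c_def d_def field_simps power2_eq_square)
    then show ?thesis unfolding mz using d by (simp add: power_divide divide_simps)
  qed
  have 4: "(mob \<gamma> \<tau> z)\<^sup>2 + 4 = qf \<gamma> \<tau> z / d\<^sup>2"
    unfolding mz qf_def d_def[symmetric] using d by (simp add: power_divide divide_simps)
  have z2: "z\<^sup>2 < \<tau>\<^sup>2" using z abs_le_square_iff[of \<tau> z] \<tau> by auto
  have "(mob \<gamma> \<tau> z)\<^sup>2 \<le> \<tau>\<^sup>2"
  proof -
    have "(\<tau>\<^sup>2 - z\<^sup>2) * c / d\<^sup>2 \<ge> 0" using z2 c by auto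
    then show ?thesis using 3 by simp
  qed
  then have "g1 (- mob \<gamma> \<tau> (- k)) (mob \<gamma> \<tau> k) \<tau> (mob \<gamma> \<tau> z) =
    sqrt \<bar>(z + k) * c / (d * e')\<bar> / (sqrt \<bar>(z - k) * c / (d * e)\<bar> * sqrt ((\<tau>\<^sup>2 - z\<^sup>2) * c / d\<^sup>2) * sqrt (qf \<gamma> \<tau> z / d\<^sup>2))"
    by (simp only: g1_sqrt 1 2 3 4)
  also have "\<dots> = sqrt \<bar>z + k\<bar> * sqrt c / (sqrt d * sqrt e')
     / ((sqrt \<bar>z - k\<bar> * sqrt c / (sqrt d * sqrt e)) * (sqrt (\<tau>\<^sup>2 - z\<^sup>2) * sqrt c / d) * (sqrt (qf \<gamma> \<tau> z) / d))"
    using c d e e' by (simp add: abs_mult real_sqrt_mult real_sqrt_divide)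
  also have "\<dots> = (d\<^sup>2 / (sqrt c)) * (sqrt e / sqrt e') *
     (sqrt \<bar>z + k\<bar> / (sqrt \<bar>z - k\<bar> * sqrt (\<tau>\<^sup>2 - z\<^sup>2) * sqrt (qf \<gamma> \<tau> z)))"
    using c d e e' by (simp add: field_simps power2_eq_square)
  also have "c / d\<^sup>2 * \<dots> = (c / sqrt c) * (sqrt e / sqrt e') *
     (sqrt \<bar>z + k\<bar> / (sqrt \<bar>z - k\<bar> * sqrt (\<tau>\<^sup>2 - z\<^sup>2) * sqrt (qf \<gamma> \<tau> z)))"
    using d by simp
  also have "c / sqrt c = sqrt c" using c by (simp add: real_div_sqrt)
  finally show ?thesis
    by (simp add: mob_const_def mob_integrand_def real_sqrt_divide c_def d_def e_def e'_def)
qed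

lemma g1_mob_substitution:
  assumes k: "0 < k" "k < \<tau>" and \<gamma>: "\<bar>\<gamma>\<bar> < \<tau>" and uv: "- \<tau> \<le> u" "u < v" "v \<le> \<tau>"
    and F: "mob_integrand k \<gamma> \<tau> absolutely_integrable_on {u..v}"
  shows "g1 (- mob \<gamma> \<tau> (- k)) (mob \<gamma> \<tau> k) \<tau> absolutely_integrable_on {mob \<gamma> \<tau> u..mob \<gamma> \<tau> v} \<and>
    integral {mob \<gamma> \<tau> u..mob \<gamma> \<tau> v} (g1 (- mob \<gamma> \<tau> (- k)) (mob \<gamma> \<tau> k) \<tau>)
      = mob_const k \<gamma> \<tau> * integral {u..v} (mob_integrand k \<gamma> \<tau>)"
proof -
  have \<tau>: "\<tau> > 0" using k by simp
  have d: "1 + \<gamma> * z / \<tau>\<^sup>2 > 0" if "u \<le> z" "z \<le> v" for z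
    using that uv \<gamma> \<tau> by (intro mob_den_pos) auto
  have "g1 (- mob \<gamma> \<tau> (- k)) (mob \<gamma> \<tau> k) \<tau> absolutely_integrable_on {mob \<gamma> \<tau> u..mob \<gamma> \<tau> v} \<and>
    integral {mob \<gamma> \<tau> u..mob \<gamma> \<tau> v} (g1 (- mob \<gamma> \<tau> (- k)) (mob \<gamma> \<tau> k) \<tau>)
      = integral {u..v} (\<lambda>z. mob_const k \<gamma> \<tau> * mob_integrand k \<gamma> \<tau> z)"
  proof (rule absolute_integral_substitution_increasing
      [where g' = "\<lambda>z. (1 - \<gamma>\<^sup>2 / \<tau>\<^sup>2) / (1 + \<gamma> * z / \<tau>\<^sup>2)\<^sup>2"])
    show "u < v" by fact
    show "continuous_on {u..v} (mob \<gamma> \<tau>)"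
      unfolding mob_def[abs_def] using \<tau> by (intro continuous_intros) (use d in force)+
    show "(\<lambda>z. mob_const k \<gamma> \<tau> * mob_integrand k \<gamma> \<tau> z) absolutely_integrable_on {u..v}"
      using set_integrable_mult_right[OF F] by blast
    fix z assume z: "u < z" "z < v"
    note dz = d[of z]
    show "(mob \<gamma> \<tau> has_real_derivative (1 - \<gamma>\<^sup>2 / \<tau>\<^sup>2) / (1 + \<gamma> * z / \<tau>\<^sup>2)\<^sup>2) (at z)"
    proof -
      have "(mob \<gamma> \<tau> has_real_derivative
         (1 * (1 + \<gamma> * z / \<tau>\<^sup>2) - (z + \<gamma>) * (\<gamma> / \<tau>\<^sup>2)) / ((1 + \<gamma> * z / \<tau>\<^sup>2) * (1 + \<gamma> * z / \<tau>\<^sup>2))) (at z)"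
        unfolding mob_def[abs_def] using dz z \<tau>
        by (intro DERIV_divide) (auto intro!: derivative_eq_intros simp: field_simps power2_eq_square)
      moreover have "1 * (1 + \<gamma> * z / \<tau>\<^sup>2) - (z + \<gamma>) * (\<gamma> / \<tau>\<^sup>2) = 1 - \<gamma>\<^sup>2 / \<tau>\<^sup>2"
        using \<tau> by (simp add: field_simps power2_eq_square)
      ultimately show ?thesis by (simp only: power2_eq_square)
    qed
    have "1 - \<gamma>\<^sup>2 / \<tau>\<^sup>2 > 0"
      using mob_den_pos[of \<tau> \<gamma> "-\<gamma>"] \<tau> \<gamma> by (simp add: power2_eq_square)
    then show "(1 - \<gamma>\<^sup>2 / \<tau>\<^sup>2) / (1 + \<gamma> * z / \<tau>\<^sup>2)\<^sup>2 > 0"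
      using dz z by auto
    show "(1 - \<gamma>\<^sup>2 / \<tau>\<^sup>2) / (1 + \<gamma> * z / \<tau>\<^sup>2)\<^sup>2 *
        g1 (- mob \<gamma> \<tau> (- k)) (mob \<gamma> \<tau> k) \<tau> (mob \<gamma> \<tau> z) = mob_const k \<gamma> \<tau> * mob_integrand k \<gamma> \<tau> z"
      by (rule g1_mob) (use k \<gamma> z uv in auto)
  qed
  then show ?thesis by simp
qed

lemma continuous_on_qf [continuous_intros]:
  fixes \<gamma> \<tau> z :: "'a::t2_space \<Rightarrow> real"
  assumes "continuous_on A \<gamma>" "continuous_on A \<tau>" "continuous_on A z" "\<And>x. x \<in> A \<Longrightarrow> \<tau> x \<noteq> 0"
  shows "continuous_on A (\<lambda>x. qf (\<gamma> x) (\<tau> x) (z x))"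
  unfolding qf_def using assms(4) by (intro continuous_intros assms(1-3)) auto

lemma qf_neq_0:
  assumes "0 < \<tau>" "\<bar>\<gamma>\<bar> < \<tau>"
  shows "sqrt (qf \<gamma> \<tau> z) \<noteq> 0"
  using qf_pos[OF assms, of z] by simp

lemma sqrt_divide_sqrt_eq:
  fixes x y :: real
  assumes "0 < x" "0 < y"
  shows "sqrt y / sqrt x = y / sqrt (x * y)"
proof -
  have "y / sqrt (x * y) = (y / sqrt y) / sqrt x" by (simp add: real_sqrt_mult)
  then show ?thesis using assms by (simp add: real_div_sqrt)
qed

text \<open>The substitution lemmas expect the root of z^2 + 4 in the denominator, whereas the
  transformed integrand has the root of \<open>qf\<close>. Here that root, as \<open>s\<close>, is
  inserted above and below the fraction.\<close>

lemma quotient_rearrange: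
  fixes a b c d s t q :: real
  assumes "s \<noteq> 0" "a / b = c / d"
  shows "a / (b * t * q) = c * s / q / (d * t * s)"
proof -
  have "a / (b * t * q) = (a / b) / (t * q)" by simp
  then show ?thesis using assms by simp
qed

section \<open>The transformed integrand on the four pieces of [-tau, tau]\<close>

lemma mob_integrand_outer_right:
  assumes k: "0 < k" "k < \<tau>" and \<gamma>: "\<bar>\<gamma>\<bar> < \<tau>"
  shows "mob_integrand k \<gamma> \<tau> absolutely_integrable_on {k..\<tau>} \<and>
    integral {k..\<tau>} (mob_integrand k \<gamma> \<tau>)
      = outer_int k \<tau> (\<lambda>z. (z + k) * sqrt (z\<^sup>2 + 4) / (z * sqrt (qf \<gamma> \<tau> z)))"
proof (rule outer_int_substitution[OF k])
  show "continuous_on {k..\<tau>} (\<lambda>z. (z + k) * sqrt (z\<^sup>2 + 4) / (z * sqrt (qf \<gamma> \<tau> z)))"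
    using k \<gamma> qf_neq_0[of \<tau> \<gamma>] by (intro continuous_intros) auto
  fix z assume z: "k < z" "z < \<tau>"
  have w: "sqrt (z\<^sup>2 + 4) > 0" by (simp add: add_nonneg_pos)
  have "sqrt \<bar>z + k\<bar> / sqrt \<bar>z - k\<bar> = (z + k) / sqrt (z\<^sup>2 - k\<^sup>2)"
    using sqrt_divide_sqrt_eq[of "z - k" "z + k"] z k by (simp add: algebra_simps power2_eq_square)
  then show "mob_integrand k \<gamma> \<tau> z = z * ((z + k) * sqrt (z\<^sup>2 + 4) / (z * sqrt (qf \<gamma> \<tau> z)))
      / sqrt ((z\<^sup>2 - k\<^sup>2) * (\<tau>\<^sup>2 - z\<^sup>2) * (z\<^sup>2 + 4))"
    using quotient_rearrange[OF less_imp_neq[OF w, symmetric]] z k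
    by (simp add: mob_integrand_def real_sqrt_mult)
qed

text \<open>Reflection moves this piece to [k, tau] and replaces \<open>qf\<close> at z by
  \<open>qf\<close> at -z, so both outer pieces become values of the same functional and can be
  added under one integral.\<close>

lemma mob_integrand_outer_left:
  assumes k: "0 < k" "k < \<tau>" and \<gamma>: "\<bar>\<gamma>\<bar> < \<tau>"
  shows "mob_integrand k \<gamma> \<tau> absolutely_integrable_on {-\<tau>..-k} \<and>
    integral {-\<tau>..-k} (mob_integrand k \<gamma> \<tau>)
      = outer_int k \<tau> (\<lambda>z. (z - k) * sqrt (z\<^sup>2 + 4) / (z * sqrt (qf \<gamma> \<tau> (- z))))"
proof -
  have "(\<lambda>z. mob_integrand k \<gamma> \<tau> (- z)) absolutely_integrable_on {k..\<tau>} \<and>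
    integral {k..\<tau>} (\<lambda>z. mob_integrand k \<gamma> \<tau> (- z))
      = outer_int k \<tau> (\<lambda>z. (z - k) * sqrt (z\<^sup>2 + 4) / (z * sqrt (qf \<gamma> \<tau> (- z))))"
  proof (rule outer_int_substitution[OF k])
    show "continuous_on {k..\<tau>} (\<lambda>z. (z - k) * sqrt (z\<^sup>2 + 4) / (z * sqrt (qf \<gamma> \<tau> (- z))))"
      using k \<gamma> qf_neq_0[of \<tau> \<gamma>] by (intro continuous_intros) auto
    fix z assume z: "k < z" "z < \<tau>"
    have w: "sqrt (z\<^sup>2 + 4) > 0" by (simp add: add_nonneg_pos)
    have "sqrt \<bar>- z + k\<bar> / sqrt \<bar>- z - k\<bar> = (z - k) / sqrt (z\<^sup>2 - k\<^sup>2)"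
      using sqrt_divide_sqrt_eq[of "z + k" "z - k"] z k by (simp add: algebra_simps power2_eq_square)
    then show "mob_integrand k \<gamma> \<tau> (- z) = z * ((z - k) * sqrt (z\<^sup>2 + 4) / (z * sqrt (qf \<gamma> \<tau> (- z))))
        / sqrt ((z\<^sup>2 - k\<^sup>2) * (\<tau>\<^sup>2 - z\<^sup>2) * (z\<^sup>2 + 4))"
      using quotient_rearrange[OF less_imp_neq[OF w, symmetric]] z k
    by (simp add: mob_integrand_def real_sqrt_mult)
  qed
  then show ?thesis
    using absolutely_integrable_reflect_real[where f="mob_integrand k \<gamma> \<tau>" and b="-k" and a="-\<tau>"]
      Henstock_Kurzweil_Integration.integral_reflect_real[of "-k" "-\<tau>" "mob_integrand k \<gamma> \<tau>"]
    by simp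
qed

text \<open>The middle interval is cut at 0 because \<open>zin\<close> covers only [0, k]; the other
  half is reflected onto the same interval.\<close>

lemma mob_integrand_inner_right:
  assumes k: "0 < k" "k < \<tau>" and \<gamma>: "\<bar>\<gamma>\<bar> < \<tau>"
  shows "mob_integrand k \<gamma> \<tau> absolutely_integrable_on {0..k} \<and>
    integral {0..k} (mob_integrand k \<gamma> \<tau>)
      = inner_int k \<tau> (\<lambda>z. (k + z) * sqrt (z\<^sup>2 + 4) / sqrt (qf \<gamma> \<tau> z))"
proof (rule inner_int_substitution[OF k])
  show "continuous_on {0..k} (\<lambda>z. (k + z) * sqrt (z\<^sup>2 + 4) / sqrt (qf \<gamma> \<tau> z))"
    using k \<gamma> qf_neq_0[of \<tau> \<gamma>] by (intro continuous_intros) auto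
  fix z assume z: "0 < z" "z < k"
  have w: "sqrt (z\<^sup>2 + 4) > 0" by (simp add: add_nonneg_pos)
  have "sqrt \<bar>z + k\<bar> / sqrt \<bar>z - k\<bar> = (k + z) / sqrt (k\<^sup>2 - z\<^sup>2)"
    using sqrt_divide_sqrt_eq[of "k - z" "k + z"] z k by (simp add: algebra_simps power2_eq_square)
  then show "mob_integrand k \<gamma> \<tau> z = (k + z) * sqrt (z\<^sup>2 + 4) / sqrt (qf \<gamma> \<tau> z)
      / sqrt ((k\<^sup>2 - z\<^sup>2) * (\<tau>\<^sup>2 - z\<^sup>2) * (z\<^sup>2 + 4))"
    using quotient_rearrange[OF less_imp_neq[OF w, symmetric]] z k
    by (simp add: mob_integrand_def real_sqrt_mult)
qed

lemma mob_integrand_inner_left: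
  assumes k: "0 < k" "k < \<tau>" and \<gamma>: "\<bar>\<gamma>\<bar> < \<tau>"
  shows "mob_integrand k \<gamma> \<tau> absolutely_integrable_on {-k..0} \<and>
    integral {-k..0} (mob_integrand k \<gamma> \<tau>)
      = inner_int k \<tau> (\<lambda>z. (k - z) * sqrt (z\<^sup>2 + 4) / sqrt (qf \<gamma> \<tau> (- z)))"
proof -
  have "(\<lambda>z. mob_integrand k \<gamma> \<tau> (- z)) absolutely_integrable_on {0..k} \<and>
    integral {0..k} (\<lambda>z. mob_integrand k \<gamma> \<tau> (- z))
      = inner_int k \<tau> (\<lambda>z. (k - z) * sqrt (z\<^sup>2 + 4) / sqrt (qf \<gamma> \<tau> (- z)))"
  proof (rule inner_int_substitution[OF k])
    show "continuous_on {0..k} (\<lambda>z. (k - z) * sqrt (z\<^sup>2 + 4) / sqrt (qf \<gamma> \<tau> (- z)))"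
      using k \<gamma> qf_neq_0[of \<tau> \<gamma>] by (intro continuous_intros) auto
    fix z assume z: "0 < z" "z < k"
    have w: "sqrt (z\<^sup>2 + 4) > 0" by (simp add: add_nonneg_pos)
    have "sqrt \<bar>- z + k\<bar> / sqrt \<bar>- z - k\<bar> = (k - z) / sqrt (k\<^sup>2 - z\<^sup>2)"
      using sqrt_divide_sqrt_eq[of "k + z" "k - z"] z k by (simp add: algebra_simps power2_eq_square)
    then show "mob_integrand k \<gamma> \<tau> (- z) = (k - z) * sqrt (z\<^sup>2 + 4) / sqrt (qf \<gamma> \<tau> (- z))
        / sqrt ((k\<^sup>2 - z\<^sup>2) * (\<tau>\<^sup>2 - z\<^sup>2) * (z\<^sup>2 + 4))"
      using quotient_rearrange[OF less_imp_neq[OF w, symmetric]] z k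
    by (simp add: mob_integrand_def real_sqrt_mult)
  qed
  then show ?thesis
    using absolutely_integrable_reflect_real[where f="mob_integrand k \<gamma> \<tau>" and b=0 and a="-k"]
      Henstock_Kurzweil_Integration.integral_reflect_real[of 0 "-k" "mob_integrand k \<gamma> \<tau>"]
    by simp
qed

section \<open>Linearity, congruence and positivity of the two functionals\<close>

lemma inner_int_linear:
  assumes "0 < k" "k < \<tau>" "continuous_on {0..k} f" "continuous_on {0..k} g"
  shows "inner_int k \<tau> (\<lambda>z. a * f z + b * g z) = a * inner_int k \<tau> f + b * inner_int k \<tau> g"
proof -
  note int = integrable_continuous_real[OF continuous_inner_integrand[OF assms(1,2)]]
  have "inner_int k \<tau> (\<lambda>z. a * f z + b * g z) = integral {0..pi/2}
    (\<lambda>\<theta>. a * (f (zin k \<theta>) / sqrt (Nin k \<tau> \<theta>)) + b * (g (zin k \<theta>) / sqrt (Nin k \<tau> \<theta>)))"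
    by (simp add: inner_int_def add_divide_distrib)
  also have "\<dots> = integral {0..pi/2} (\<lambda>\<theta>. a * (f (zin k \<theta>) / sqrt (Nin k \<tau> \<theta>)))
      + integral {0..pi/2} (\<lambda>\<theta>. b * (g (zin k \<theta>) / sqrt (Nin k \<tau> \<theta>)))"
    by (intro integral_add integrable_on_mult_right int assms)
  finally show ?thesis
    by (simp only: inner_int_def integral_mult_right)
qed

lemma outer_int_linear:
  assumes "0 < k" "k < \<tau>" "continuous_on {k..\<tau>} f" "continuous_on {k..\<tau>} g"
  shows "outer_int k \<tau> (\<lambda>z. a * f z + b * g z) = a * outer_int k \<tau> f + b * outer_int k \<tau> g"
proof -
  note int = integrable_continuous_real[OF continuous_outer_integrand[OF assms(1,2)]]
  have "outer_int k \<tau> (\<lambda>z. a * f z + b * g z) = integral {0..pi/2}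
    (\<lambda>\<theta>. a * (f (zout k \<tau> \<theta>) / sqrt (Lout k \<tau> \<theta>)) + b * (g (zout k \<tau> \<theta>) / sqrt (Lout k \<tau> \<theta>)))"
    by (simp add: outer_int_def add_divide_distrib)
  also have "\<dots> = integral {0..pi/2} (\<lambda>\<theta>. a * (f (zout k \<tau> \<theta>) / sqrt (Lout k \<tau> \<theta>)))
      + integral {0..pi/2} (\<lambda>\<theta>. b * (g (zout k \<tau> \<theta>) / sqrt (Lout k \<tau> \<theta>)))"
    by (intro integral_add integrable_on_mult_right int assms)
  finally show ?thesis
    by (simp only: outer_int_def integral_mult_right)
qed

lemma inner_int_cong:
  assumes "0 < k" "\<And>z. 0 \<le> z \<Longrightarrow> z \<le> k \<Longrightarrow> f z = g z"
  shows "inner_int k \<tau> f = inner_int k \<tau> g"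
  unfolding inner_int_def
  by (rule integral_cong) (use assms zin_bounds in auto)

lemma outer_int_cong:
  assumes "0 < k" "k < \<tau>" "\<And>z. k \<le> z \<Longrightarrow> z \<le> \<tau> \<Longrightarrow> f z = g z"
  shows "outer_int k \<tau> f = outer_int k \<tau> g"
  unfolding outer_int_def
  by (rule integral_cong) (use assms zout_bounds in auto)

lemma inner_int_pos:
  assumes "0 < k" "k < \<tau>" "continuous_on {0..k} f" "\<And>z. 0 \<le> z \<Longrightarrow> z \<le> k \<Longrightarrow> f z > 0"
  shows "inner_int k \<tau> f > 0"
proof -
  have "integral {0..pi/2} (\<lambda>_. 0) < integral {0..pi/2} (\<lambda>\<theta>. f (zin k \<theta>) / sqrt (Nin k \<tau> \<theta>))"
  proof (rule integral_less_real)
    show "continuous_on {0..pi/2} (\<lambda>\<theta>. f (zin k \<theta>) / sqrt (Nin k \<tau> \<theta>))"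
      by (intro continuous_inner_integrand assms)
    show "0 < f (zin k \<theta>) / sqrt (Nin k \<tau> \<theta>)" if "\<theta> \<in> {0<..<pi/2}" for \<theta>
      using that assms zin_bounds[of k \<theta>] Nin_pos[of k \<tau> \<theta>] by auto
  qed (use pi_gt_zero in \<open>auto simp: not_le\<close>)
  then show ?thesis by (simp add: inner_int_def)
qed

section \<open>Even and odd parts of the transformed weight\<close>

definition Psum :: "real \<Rightarrow> real \<Rightarrow> real \<Rightarrow> real" where
  "Psum \<gamma> \<tau> z = sqrt (z\<^sup>2 + 4) * (1 / sqrt (qf \<gamma> \<tau> z) + 1 / sqrt (qf \<gamma> \<tau> (- z)))"

text \<open>While \<open>Psum\<close> is twice the even part of the weight sqrt (z^2 + 4) / sqrt
  \<open>qf\<close>, this is its odd part with the factors gamma and z removed, as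
  \<open>Rdiff_eq\<close> makes precise. Rationalising first avoids any division by gamma, so the
  expression makes sense and is continuous at gamma = 0.\<close>

definition Rdiff :: "real \<Rightarrow> real \<Rightarrow> real \<Rightarrow> real" where
  "Rdiff \<gamma> \<tau> z = sqrt (z\<^sup>2 + 4) / (sqrt (qf \<gamma> \<tau> z) * sqrt (qf \<gamma> \<tau> (- z)) *
     (sqrt (qf \<gamma> \<tau> z) + sqrt (qf \<gamma> \<tau> (- z))))"

text \<open>The function H of the overview: what is left, up to a positive factor, when the two
  quotients in Q are cross-multiplied.\<close>

definition period_det :: "real \<Rightarrow> real \<Rightarrow> real \<Rightarrow> real" where
  "period_det k \<gamma> \<tau> = outer_int k \<tau> (Psum \<gamma> \<tau>) * inner_int k \<tau> (\<lambda>z. z\<^sup>2 * Rdiff \<gamma> \<tau> z)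
     - k\<^sup>2 * inner_int k \<tau> (Psum \<gamma> \<tau>) * outer_int k \<tau> (Rdiff \<gamma> \<tau>)"

lemma qf_minus: "qf (- \<gamma>) \<tau> z = qf \<gamma> \<tau> (- z)"
  by (simp add: qf_def power2_eq_square algebra_simps)

lemma Psum_minus: "Psum (- \<gamma>) \<tau> = Psum \<gamma> \<tau>"
  by (simp add: fun_eq_iff Psum_def qf_minus)

lemma Rdiff_minus: "Rdiff (- \<gamma>) \<tau> = Rdiff \<gamma> \<tau>"
  by (simp add: fun_eq_iff Rdiff_def qf_minus mult.commute add.commute)

lemma continuous_on_Psum [continuous_intros]:
  fixes \<gamma> \<tau> z :: "'a::t2_space \<Rightarrow> real"
  assumes "continuous_on A \<gamma>" "continuous_on A \<tau>" "continuous_on A z"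
    and "\<And>x. x \<in> A \<Longrightarrow> 0 < \<tau> x" "\<And>x. x \<in> A \<Longrightarrow> \<bar>\<gamma> x\<bar> < \<tau> x"
  shows "continuous_on A (\<lambda>x. Psum (\<gamma> x) (\<tau> x) (z x))"
proof -
  have "\<tau> x \<noteq> 0" "sqrt (qf (\<gamma> x) (\<tau> x) y) \<noteq> 0" if "x \<in> A" for x y
    using assms(4,5)[OF that] qf_neq_0[of "\<tau> x" "\<gamma> x" y] by auto
  then show ?thesis
    unfolding Psum_def by (intro continuous_intros assms(1-3)) auto
qed

lemma continuous_on_Rdiff [continuous_intros]:
  fixes \<gamma> \<tau> z :: "'a::t2_space \<Rightarrow> real"
  assumes "continuous_on A \<gamma>" "continuous_on A \<tau>" "continuous_on A z"
    and "\<And>x. x \<in> A \<Longrightarrow> 0 < \<tau> x" "\<And>x. x \<in> A \<Longrightarrow> \<bar>\<gamma> x\<bar> < \<tau> x"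
  shows "continuous_on A (\<lambda>x. Rdiff (\<gamma> x) (\<tau> x) (z x))"
proof -
  have 1: "sqrt (qf (\<gamma> x) (\<tau> x) y) > 0" if "x \<in> A" for x y
    using assms(4,5)[OF that] qf_pos[of "\<tau> x" "\<gamma> x" y] by auto
  have 2: "sqrt (qf (\<gamma> x) (\<tau> x) (z x)) * sqrt (qf (\<gamma> x) (\<tau> x) (- z x)) *
     (sqrt (qf (\<gamma> x) (\<tau> x) (z x)) + sqrt (qf (\<gamma> x) (\<tau> x) (- z x))) \<noteq> 0" if "x \<in> A" for x
    using 1[OF that, of "z x"] 1[OF that, of "- z x"] by (metis add_pos_pos mult_pos_pos less_irrefl)
  have "\<tau> x \<noteq> 0" if "x \<in> A" for x using assms(4)[OF that] by simp
  with 2 show ?thesis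
    unfolding Rdiff_def by (intro continuous_intros assms(1-3)) auto
qed

text \<open>Multiplying by the conjugate S + S' turns the difference of roots into \<open>qf\<close>
  at -z minus \<open>qf\<close> at z. Only the cross terms of the two squares survive there, and
  each of them carries gamma * z.\<close>

lemma Rdiff_eq:
  assumes "0 < \<tau>" "\<bar>\<gamma>\<bar> < \<tau>"
  shows "sqrt (z\<^sup>2 + 4) * (1 / sqrt (qf \<gamma> \<tau> z) - 1 / sqrt (qf \<gamma> \<tau> (- z)))
    = - (4 * \<gamma> * (1 + 4 / \<tau>\<^sup>2)) * (z * Rdiff \<gamma> \<tau> z)"
proof -
  define S S' where "S = sqrt (qf \<gamma> \<tau> z)" and "S' = sqrt (qf \<gamma> \<tau> (- z))"
  have S: "S > 0" "S' > 0" using qf_pos[OF assms] by (auto simp: S_def S'_def)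
  have "(S' - S) * (S + S') = S'\<^sup>2 - S\<^sup>2" by (simp add: algebra_simps power2_eq_square)
  also have "\<dots> = qf \<gamma> \<tau> (- z) - qf \<gamma> \<tau> z"
    using qf_pos[OF assms] by (simp add: S_def S'_def less_imp_le)
  also have "\<dots> = - (4 * \<gamma> * (1 + 4 / \<tau>\<^sup>2)) * z"
    using assms by (simp add: qf_def power2_eq_square field_simps)
  finally have *: "(S' - S) * (S + S') = - (4 * \<gamma> * (1 + 4 / \<tau>\<^sup>2)) * z" .
  have "1 / S - 1 / S' = ((S' - S) * (S + S')) / (S * S' * (S + S'))"
    using S by (simp add: divide_simps)
  then show ?thesis
    unfolding * Rdiff_def S_def[symmetric] S'_def[symmetric] by simp
qed

lemma mob_tau: "0 < \<tau> \<Longrightarrow> \<bar>\<gamma>\<bar> < \<tau> \<Longrightarrow> mob \<gamma> \<tau> \<tau> = \<tau>"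
  and mob_minus_tau: "0 < \<tau> \<Longrightarrow> \<bar>\<gamma>\<bar> < \<tau> \<Longrightarrow> mob \<gamma> \<tau> (- \<tau>) = - \<tau>"
  by (auto simp: mob_def field_simps power2_eq_square)

lemma mob_minus: "mob (- \<gamma>) \<tau> z = - mob \<gamma> \<tau> (- z)"
  by (simp add: mob_def divide_simps)

lemma period_quotient:
  assumes k: "0 < k" "k < \<tau>" and \<gamma>: "\<bar>\<gamma>\<bar> < \<tau>"
  defines "\<alpha> \<equiv> - mob \<gamma> \<tau> (- k)" and "\<beta> \<equiv> mob \<gamma> \<tau> k" and "\<kappa> \<equiv> 4 * \<gamma> * (1 + 4 / \<tau>\<^sup>2)"
  shows "(integral {-\<tau>..-\<alpha>} (g1 \<alpha> \<beta> \<tau>) + integral {\<beta>..\<tau>} (g1 \<alpha> \<beta> \<tau>)) / integral {-\<alpha>..\<beta>} (g1 \<alpha> \<beta> \<tau>)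
     = (outer_int k \<tau> (Psum \<gamma> \<tau>) - k * \<kappa> * outer_int k \<tau> (Rdiff \<gamma> \<tau>))
       / (k * inner_int k \<tau> (Psum \<gamma> \<tau>) - \<kappa> * inner_int k \<tau> (\<lambda>z. z\<^sup>2 * Rdiff \<gamma> \<tau> z))"
    and "k * inner_int k \<tau> (Psum \<gamma> \<tau>) - \<kappa> * inner_int k \<tau> (\<lambda>z. z\<^sup>2 * Rdiff \<gamma> \<tau> z) > 0"
proof -
  have \<tau>: "\<tau> > 0" using k by simp
  define C where "C = mob_const k \<gamma> \<tau>"
  have C: "C > 0" using mob_const_pos k \<gamma> by (simp add: C_def)
  define f1 where "f1 z = (z + k) * sqrt (z\<^sup>2 + 4) / (z * sqrt (qf \<gamma> \<tau> z))" for z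
  define f2 where "f2 z = (z - k) * sqrt (z\<^sup>2 + 4) / (z * sqrt (qf \<gamma> \<tau> (- z)))" for z
  define f3 where "f3 z = (k + z) * sqrt (z\<^sup>2 + 4) / sqrt (qf \<gamma> \<tau> z)" for z
  define f4 where "f4 z = (k - z) * sqrt (z\<^sup>2 + 4) / sqrt (qf \<gamma> \<tau> (- z))" for z
  have cf: "continuous_on {k..\<tau>} f1" "continuous_on {k..\<tau>} f2"
      "continuous_on {0..k} f3" "continuous_on {0..k} f4"
    unfolding f1_def[abs_def] f2_def[abs_def] f3_def[abs_def] f4_def[abs_def]
    using k \<gamma> qf_neq_0[of \<tau> \<gamma>] by (auto intro!: continuous_intros)
  have cP: "continuous_on X (Psum \<gamma> \<tau>)" and cR: "continuous_on X (Rdiff \<gamma> \<tau>)" for X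
    using \<tau> \<gamma> by (auto intro!: continuous_intros)
  have I3: "integral {\<beta>..\<tau>} (g1 \<alpha> \<beta> \<tau>) = C * outer_int k \<tau> f1"
    using g1_mob_substitution[OF k \<gamma>, of k \<tau>] mob_integrand_outer_right[OF k \<gamma>] k
    by (simp add: \<alpha>_def \<beta>_def mob_tau \<tau> \<gamma> C_def f1_def[abs_def])
  have I1: "integral {-\<tau>..-\<alpha>} (g1 \<alpha> \<beta> \<tau>) = C * outer_int k \<tau> f2"
    using g1_mob_substitution[OF k \<gamma>, of "-\<tau>" "-k"] mob_integrand_outer_left[OF k \<gamma>] k
    by (simp add: \<alpha>_def \<beta>_def mob_minus_tau \<tau> \<gamma> C_def f2_def[abs_def])
  have I2a: "g1 \<alpha> \<beta> \<tau> absolutely_integrable_on {mob \<gamma> \<tau> 0..\<beta>} \<and>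
      integral {mob \<gamma> \<tau> 0..\<beta>} (g1 \<alpha> \<beta> \<tau>) = C * inner_int k \<tau> f3"
    using g1_mob_substitution[OF k \<gamma>, of 0 k] mob_integrand_inner_right[OF k \<gamma>] k
    by (simp add: \<alpha>_def \<beta>_def \<tau> \<gamma> C_def f3_def[abs_def])
  have I2b: "g1 \<alpha> \<beta> \<tau> absolutely_integrable_on {-\<alpha>..mob \<gamma> \<tau> 0} \<and>
      integral {-\<alpha>..mob \<gamma> \<tau> 0} (g1 \<alpha> \<beta> \<tau>) = C * inner_int k \<tau> f4"
    using g1_mob_substitution[OF k \<gamma>, of "-k" 0] mob_integrand_inner_left[OF k \<gamma>] k
    by (simp add: \<alpha>_def \<beta>_def \<tau> \<gamma> C_def f4_def[abs_def])
  have I2: "integral {-\<alpha>..\<beta>} (g1 \<alpha> \<beta> \<tau>) = C * (inner_int k \<tau> f3 + inner_int k \<tau> f4)"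
  proof -
    have e: "1 + \<gamma> * k / \<tau>\<^sup>2 > 0" "1 - \<gamma> * k / \<tau>\<^sup>2 > 0"
      using mob_den_pos[of \<tau> \<gamma> k] mob_den_pos[of \<tau> \<gamma> "-k"] k \<gamma> by auto
    have c: "1 - \<gamma> * \<gamma> / \<tau>\<^sup>2 > 0"
      using mob_den_pos[of \<tau> \<gamma> "-\<gamma>"] \<tau> \<gamma> by simp
    \<comment> \<open>The halves meet at the image of 0, which is gamma. That it lies between -alpha
      and beta reduces on both sides to this inequality.\<close>
    have le: "k * (\<gamma> * \<gamma> / \<tau>\<^sup>2) \<le> k * 1"
      using k c by (intro mult_left_mono) auto
    have 1: "mob \<gamma> \<tau> 0 \<le> \<beta>"
      unfolding \<beta>_def mob_def using e(1) le by (simp add: pos_le_divide_eq algebra_simps)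
    have 2: "-\<alpha> \<le> mob \<gamma> \<tau> 0"
      unfolding \<alpha>_def mob_def using e(2) le by (simp add: pos_divide_le_eq algebra_simps)
    have "(g1 \<alpha> \<beta> \<tau> has_integral (C * inner_int k \<tau> f4 + C * inner_int k \<tau> f3)) {-\<alpha>..\<beta>}"
      using I2a I2b by (intro has_integral_combine[OF 2 1])
        (auto simp: has_integral_iff set_lebesgue_integral_eq_integral)
    then show ?thesis by (simp add: integral_unique algebra_simps)
  qed
  have out: "outer_int k \<tau> f1 + outer_int k \<tau> f2
      = outer_int k \<tau> (Psum \<gamma> \<tau>) - k * \<kappa> * outer_int k \<tau> (Rdiff \<gamma> \<tau>)"
  proof -
    have "outer_int k \<tau> f1 + outer_int k \<tau> f2 = outer_int k \<tau> (\<lambda>z. 1 * f1 z + 1 * f2 z)"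
      using outer_int_linear[OF k cf(1,2), of 1 1] by simp
    also have "\<dots> = outer_int k \<tau> (\<lambda>z. 1 * Psum \<gamma> \<tau> z + (- (k * \<kappa>)) * Rdiff \<gamma> \<tau> z)"
    proof (rule outer_int_cong[OF k])
      fix z assume z: "k \<le> z" "z \<le> \<tau>"
      have "f1 z + f2 z = Psum \<gamma> \<tau> z
        + k / z * (sqrt (z\<^sup>2 + 4) * (1 / sqrt (qf \<gamma> \<tau> z) - 1 / sqrt (qf \<gamma> \<tau> (- z))))"
      proof -
        have "(z + k) * w / (z * S) + (z - k) * w / (z * S') = w * (1 / S + 1 / S') + k / z * (w * (1 / S - 1 / S'))"
          for w S S' :: real
          using z k by (cases "S = 0"; cases "S' = 0") (simp_all add: field_simps)
        then show ?thesis unfolding f1_def f2_def Psum_def by blast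
      qed
      also have "\<dots> = Psum \<gamma> \<tau> z - k * \<kappa> * Rdiff \<gamma> \<tau> z"
        unfolding Rdiff_eq[OF \<tau> \<gamma>] \<kappa>_def[symmetric] using z k by simp
      finally show "1 * f1 z + 1 * f2 z = 1 * Psum \<gamma> \<tau> z + (- (k * \<kappa>)) * Rdiff \<gamma> \<tau> z"
        by simp
    qed
    also have "\<dots> = outer_int k \<tau> (Psum \<gamma> \<tau>) - k * \<kappa> * outer_int k \<tau> (Rdiff \<gamma> \<tau>)"
      using outer_int_linear[OF k cP cR, of 1 "- (k * \<kappa>)"] by simp
    finally show ?thesis .
  qed
  have inn0: "inner_int k \<tau> f3 + inner_int k \<tau> f4 = inner_int k \<tau> (\<lambda>z. 1 * f3 z + 1 * f4 z)"
    using inner_int_linear[OF k cf(3,4), of 1 1] by simp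
  also have "\<dots> = inner_int k \<tau> (\<lambda>z. k * Psum \<gamma> \<tau> z + (- \<kappa>) * (z\<^sup>2 * Rdiff \<gamma> \<tau> z))"
  proof (rule inner_int_cong[OF k(1)])
    fix z assume z: "0 \<le> z" "z \<le> k"
    have "f3 z + f4 z = k * Psum \<gamma> \<tau> z
      + z * (sqrt (z\<^sup>2 + 4) * (1 / sqrt (qf \<gamma> \<tau> z) - 1 / sqrt (qf \<gamma> \<tau> (- z))))"
    proof -
      have "(k + z) * w / S + (k - z) * w / S' = k * (w * (1 / S + 1 / S')) + z * (w * (1 / S - 1 / S'))"
        for w S S' :: real
        by (cases "S = 0"; cases "S' = 0") (simp_all add: field_simps)
      then show ?thesis unfolding f3_def f4_def Psum_def by blast
    qed
    also have "\<dots> = k * Psum \<gamma> \<tau> z - \<kappa> * (z\<^sup>2 * Rdiff \<gamma> \<tau> z)"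
      unfolding Rdiff_eq[OF \<tau> \<gamma>] \<kappa>_def[symmetric] by (simp add: power2_eq_square)
    finally show "1 * f3 z + 1 * f4 z = k * Psum \<gamma> \<tau> z + (- \<kappa>) * (z\<^sup>2 * Rdiff \<gamma> \<tau> z)"
      by simp
  qed
  also have "\<dots> = k * inner_int k \<tau> (Psum \<gamma> \<tau>) - \<kappa> * inner_int k \<tau> (\<lambda>z. z\<^sup>2 * Rdiff \<gamma> \<tau> z)"
    using inner_int_linear[OF k cP, of "\<lambda>z. z\<^sup>2 * Rdiff \<gamma> \<tau> z" k "- \<kappa>"] cR
    by (simp add: continuous_intros)
  finally have inn: "inner_int k \<tau> f3 + inner_int k \<tau> f4
    = k * inner_int k \<tau> (Psum \<gamma> \<tau>) - \<kappa> * inner_int k \<tau> (\<lambda>z. z\<^sup>2 * Rdiff \<gamma> \<tau> z)" .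
  show "(integral {-\<tau>..-\<alpha>} (g1 \<alpha> \<beta> \<tau>) + integral {\<beta>..\<tau>} (g1 \<alpha> \<beta> \<tau>)) / integral {-\<alpha>..\<beta>} (g1 \<alpha> \<beta> \<tau>)
     = (outer_int k \<tau> (Psum \<gamma> \<tau>) - k * \<kappa> * outer_int k \<tau> (Rdiff \<gamma> \<tau>))
       / (k * inner_int k \<tau> (Psum \<gamma> \<tau>) - \<kappa> * inner_int k \<tau> (\<lambda>z. z\<^sup>2 * Rdiff \<gamma> \<tau> z))"
    unfolding I1 I2 I3 inn[symmetric] out[symmetric] using C
    by (simp add: distrib_left[symmetric] add.commute)
  show "k * inner_int k \<tau> (Psum \<gamma> \<tau>) - \<kappa> * inner_int k \<tau> (\<lambda>z. z\<^sup>2 * Rdiff \<gamma> \<tau> z) > 0"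
    unfolding inn[symmetric] inn0
  proof (rule inner_int_pos[OF k])
    show "continuous_on {0..k} (\<lambda>z. 1 * f3 z + 1 * f4 z)"
      using cf by (intro continuous_intros)
    fix z assume z: "0 \<le> z" "z \<le> k"
    have w: "sqrt (z\<^sup>2 + 4) > 0" by (simp add: add_nonneg_pos)
    \<comment> \<open>\<open>f4\<close> vanishes at z = k, so the strict sign required on the whole
      closed interval is taken from \<open>f3\<close>.\<close>
    have "f3 z > 0" using z k w qf_pos[OF \<tau> \<gamma>, of z] by (simp add: f3_def)
    moreover have "f4 z \<ge> 0"
      using z k w qf_pos[OF \<tau> \<gamma>, of "- z"] by (simp add: f4_def)
    ultimately show "1 * f3 z + 1 * f4 z > 0" by simp
  qed
qed

text \<open>Through this the integrals J are integrals of \<open>g1\<close> with alpha and beta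
  exchanged, which amounts to replacing gamma by -gamma.\<close>

lemma g2_eq_g1_reflected: "g2 \<alpha> \<beta> \<tau> = (\<lambda>\<zeta>. g1 \<beta> \<alpha> \<tau> (- \<zeta>))"
proof
  fix \<zeta>
  have "\<bar>- \<zeta> + \<beta>\<bar> = \<bar>\<zeta> - \<beta>\<bar>" "\<bar>- \<zeta> - \<alpha>\<bar> = \<bar>\<zeta> + \<alpha>\<bar>" by auto
  then show "g2 \<alpha> \<beta> \<tau> \<zeta> = g1 \<beta> \<alpha> \<tau> (- \<zeta>)" by (simp add: g1_def g2_def)
qed

text \<open>Q is a quotient at gamma minus the same quotient at -gamma, with positive denominators.
  After cross-multiplication the terms even in gamma cancel and \<open>2 * \<kappa>\<close> times
  \<open>period_det\<close> is left, where \<open>\<kappa>\<close> is positive because gamma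
  is.\<close>

lemma Qfun_zero_iff:
  assumes k: "0 < k" "k < \<tau>" and \<gamma>: "0 < \<gamma>" "\<gamma> < \<tau>"
  shows "Qfun (- mob \<gamma> \<tau> (- k)) (mob \<gamma> \<tau> k) \<tau> = 0 \<longleftrightarrow> period_det k \<gamma> \<tau> = 0"
proof -
  define \<alpha> where "\<alpha> = - mob \<gamma> \<tau> (- k)"
  define \<beta> where "\<beta> = mob \<gamma> \<tau> k"
  define \<kappa> where "\<kappa> = 4 * \<gamma> * (1 + 4 / \<tau>\<^sup>2)"
  define Mo where "Mo = outer_int k \<tau> (Psum \<gamma> \<tau>)"
  define V where "V = outer_int k \<tau> (Rdiff \<gamma> \<tau>)"
  define Ni where "Ni = inner_int k \<tau> (Psum \<gamma> \<tau>)"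
  define U where "U = inner_int k \<tau> (\<lambda>z. z\<^sup>2 * Rdiff \<gamma> \<tau> z)"
  have \<kappa>: "\<kappa> > 0" using \<gamma> by (simp add: \<kappa>_def add_pos_nonneg)
  have refl: "integral {-b..-a} (g2 \<alpha> \<beta> \<tau>) = integral {a..b} (g1 \<beta> \<alpha> \<tau>)" for a b
    unfolding g2_eq_g1_reflected by (rule Henstock_Kurzweil_Integration.integral_reflect_real)
  have "Qfun \<alpha> \<beta> \<tau> = (integral {-\<tau>..-\<alpha>} (g1 \<alpha> \<beta> \<tau>) + integral {\<beta>..\<tau>} (g1 \<alpha> \<beta> \<tau>)) / integral {-\<alpha>..\<beta>} (g1 \<alpha> \<beta> \<tau>)
    - (integral {-\<tau>..-\<beta>} (g1 \<beta> \<alpha> \<tau>) + integral {\<alpha>..\<tau>} (g1 \<beta> \<alpha> \<tau>)) / integral {-\<beta>..\<alpha>} (g1 \<beta> \<alpha> \<tau>)"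
    using refl[of \<tau> \<alpha>] refl[of "-\<beta>" "-\<tau>"] refl[of "\<alpha>" "-\<beta>"]
    by (simp add: Qfun_def Let_def add.commute)
  also have "\<dots> = (Mo - k * \<kappa> * V) / (k * Ni - \<kappa> * U) - (Mo + k * \<kappa> * V) / (k * Ni + \<kappa> * U)"
    using period_quotient(1)[OF k, of \<gamma>] period_quotient(1)[OF k, of "-\<gamma>"] \<gamma>
    by (simp add: \<alpha>_def \<beta>_def mob_minus Psum_minus Rdiff_minus Mo_def V_def Ni_def U_def \<kappa>_def)
  finally have Q: "Qfun \<alpha> \<beta> \<tau> = \<dots>" .
  have pos: "k * Ni - \<kappa> * U > 0" "k * Ni + \<kappa> * U > 0"
    using period_quotient(2)[OF k, of \<gamma>] period_quotient(2)[OF k, of "-\<gamma>"] \<gamma>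
    by (simp_all add: Psum_minus Rdiff_minus Ni_def U_def \<kappa>_def)
  have "Qfun \<alpha> \<beta> \<tau> = 0 \<longleftrightarrow> (Mo - k * \<kappa> * V) * (k * Ni + \<kappa> * U) = (Mo + k * \<kappa> * V) * (k * Ni - \<kappa> * U)"
    unfolding Q using pos by (simp add: frac_eq_eq)
  also have "\<dots> \<longleftrightarrow> 2 * \<kappa> * (Mo * U - k\<^sup>2 * Ni * V) = 0"
    by (auto simp: algebra_simps power2_eq_square)
  also have "\<dots> \<longleftrightarrow> period_det k \<gamma> \<tau> = 0"
    using \<kappa> by (simp add: period_det_def Mo_def V_def Ni_def U_def)
  finally show ?thesis by (simp add: \<alpha>_def \<beta>_def)
qed

section \<open>Continuity of the period function\<close>

text \<open>In the angle variable the integrand is jointly continuous on \<open>U\<close> times a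
  compact interval, endpoints included, so continuity of the integral follows from joint continuity
  alone.\<close>

lemma continuous_on_outer_param:
  fixes f :: "'a::t2_space \<Rightarrow> real \<Rightarrow> real" and k \<tau> :: "'a \<Rightarrow> real"
  assumes "continuous_on U k" "continuous_on U \<tau>"
    and "continuous_on (U \<times> {0..pi/2}) (\<lambda>x. f (fst x) (zout (k (fst x)) (\<tau> (fst x)) (snd x)))"
  shows "continuous_on U (\<lambda>x. outer_int (k x) (\<tau> x) (f x))"
proof -
  have fst: "continuous_on (U \<times> {0..pi/2}) (\<lambda>x. k (fst x))" "continuous_on (U \<times> {0..pi/2}) (\<lambda>x. \<tau> (fst x))"
    by (rule continuous_on_compose2[OF assms(1)], auto intro: continuous_on_fst continuous_on_id)
      (rule continuous_on_compose2[OF assms(2)], auto intro: continuous_on_fst continuous_on_id)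
  have "sqrt (Lout a b c) \<noteq> 0" for a b c using Lout_pos[of a b c] by simp
  then have "continuous_on (U \<times> {0..pi/2}) (\<lambda>x. f (fst x) (zout (k (fst x)) (\<tau> (fst x)) (snd x))
      / sqrt (Lout (k (fst x)) (\<tau> (fst x)) (snd x)))"
    by (intro continuous_on_divide assms(3) continuous_on_real_sqrt continuous_on_Lout fst
        continuous_on_snd continuous_on_id) auto
  then have "continuous_on (U \<times> cbox 0 (pi/2)) (\<lambda>(x, \<theta>). f x (zout (k x) (\<tau> x) \<theta>)
      / sqrt (Lout (k x) (\<tau> x) \<theta>))"
    by (simp add: case_prod_unfold)
  from integral_continuous_on_param[OF this] show ?thesis
    by (simp add: outer_int_def)
qed

text \<open>Unlike \<open>Lout\<close>, \<open>Nin\<close> can vanish, namely at pi/2 when k reaches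
  tau; the bounds on k keep it positive.\<close>

lemma continuous_on_inner_param:
  fixes f :: "'a::t2_space \<Rightarrow> real \<Rightarrow> real" and k \<tau> :: "'a \<Rightarrow> real"
  assumes "continuous_on U k" "continuous_on U \<tau>" "\<And>x. x \<in> U \<Longrightarrow> 0 < k x \<and> k x < \<tau> x"
    and "continuous_on (U \<times> {0..pi/2}) (\<lambda>x. f (fst x) (zin (k (fst x)) (snd x)))"
  shows "continuous_on U (\<lambda>x. inner_int (k x) (\<tau> x) (f x))"
proof -
  have fst: "continuous_on (U \<times> {0..pi/2}) (\<lambda>x. k (fst x))" "continuous_on (U \<times> {0..pi/2}) (\<lambda>x. \<tau> (fst x))"
    by (rule continuous_on_compose2[OF assms(1)], auto intro: continuous_on_fst continuous_on_id)
      (rule continuous_on_compose2[OF assms(2)], auto intro: continuous_on_fst continuous_on_id)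
  have "sqrt (Nin (k x) (\<tau> x) c) \<noteq> 0" if "x \<in> U" for x c
    using Nin_pos[of "k x" "\<tau> x" c] assms(3)[OF that] by simp
  then have "continuous_on (U \<times> {0..pi/2}) (\<lambda>x. f (fst x) (zin (k (fst x)) (snd x))
      / sqrt (Nin (k (fst x)) (\<tau> (fst x)) (snd x)))"
    by (intro continuous_on_divide assms(4) continuous_on_real_sqrt continuous_on_Nin fst
        continuous_on_snd continuous_on_id) auto
  then have "continuous_on (U \<times> cbox 0 (pi/2)) (\<lambda>(x, \<theta>). f x (zin (k x) \<theta>)
      / sqrt (Nin (k x) (\<tau> x) \<theta>))"
    by (simp add: case_prod_unfold)
  from integral_continuous_on_param[OF this] show ?thesis
    by (simp add: inner_int_def)
qed

lemma continuous_on_period_det: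
  fixes k \<gamma> \<tau> :: "'a::t2_space \<Rightarrow> real"
  assumes c: "continuous_on U k" "continuous_on U \<gamma>" "continuous_on U \<tau>"
    and U: "\<And>x. x \<in> U \<Longrightarrow> 0 < k x \<and> k x < \<tau> x \<and> \<bar>\<gamma> x\<bar> < \<tau> x"
  shows "continuous_on U (\<lambda>x. period_det (k x) (\<gamma> x) (\<tau> x))"
proof -
  have fst: "continuous_on (U \<times> {0..pi/2}) (\<lambda>x. h (fst x))" if "continuous_on U h" for h :: "'a \<Rightarrow> real"
    by (rule continuous_on_compose2[OF that]) (auto intro: continuous_on_fst continuous_on_id)
  have U\<tau>: "\<And>x. x \<in> U \<Longrightarrow> 0 < \<tau> x" using U less_trans by blast
  have P: "continuous_on (U \<times> {0..pi/2}) (\<lambda>x. Psum (\<gamma> (fst x)) (\<tau> (fst x)) (z x))"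
    and R: "continuous_on (U \<times> {0..pi/2}) (\<lambda>x. Rdiff (\<gamma> (fst x)) (\<tau> (fst x)) (z x))"
    if "continuous_on (U \<times> {0..pi/2}) z" for z :: "'a \<times> real \<Rightarrow> real"
    using U U\<tau> by (auto intro!: continuous_on_Psum continuous_on_Rdiff fst c that)
  have zi: "continuous_on (U \<times> {0..pi/2}) (\<lambda>x. zin (k (fst x)) (snd x))"
    by (intro continuous_on_zin fst c continuous_on_snd continuous_on_id)
  have zo: "continuous_on (U \<times> {0..pi/2}) (\<lambda>x. zout (k (fst x)) (\<tau> (fst x)) (snd x))"
    by (intro continuous_on_zout fst c continuous_on_snd continuous_on_id)
  show ?thesis
    unfolding period_det_def
    by (intro continuous_on_diff continuous_on_mult continuous_on_power continuous_on_outer_param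
        continuous_on_inner_param P R zi zo c)
      (use U in auto)
qed

text \<open>
  With $\alpha=\tau\tanh x$ and $\beta=\tau\tanh y$, the Moebius map is translation by
  $(y-x)/2$ in the variable $\mathrm{artanh}(z/\tau)$.
\<close>

definition period_fun :: "real \<times> real \<times> real \<Rightarrow> real" where
  "period_fun = (\<lambda>(\<alpha>, \<beta>, \<tau>). period_det
     (\<tau> * tanh ((artanh (\<alpha> / \<tau>) + artanh (\<beta> / \<tau>)) / 2))
     (\<tau> * tanh ((artanh (\<beta> / \<tau>) - artanh (\<alpha> / \<tau>)) / 2)) \<tau>)"

text \<open>An open set with no order imposed between alpha and beta: a point of the diagonal is
  interior to it, so \<open>period_fun\<close> is continuous across alpha = beta and balls around
  diagonal points can be used.\<close>

definition pos_params :: "(real \<times> real \<times> real) set" where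
  "pos_params = {(\<alpha>, \<beta>, \<tau>). 0 < \<alpha> \<and> \<alpha> < \<tau> \<and> 0 < \<beta> \<and> \<beta> < \<tau>}"

section \<open>Parameters in the artanh coordinate\<close>

lemma tanh_artanh_real:
  assumes "-1 < x" "x < (1::real)"
  shows "tanh (artanh x) = x"
proof -
  have "exp (- 2 * artanh x) = (1 - x) / (1 + x)"
    using assms by (simp add: artanh_def exp_minus)
  then show ?thesis
    using assms by (simp only: tanh_real_altdef) (simp add: field_simps)
qed

lemma artanh_pos:
  assumes "0 < x" "x < (1::real)"
  shows "artanh x > 0"
  using assms tanh_artanh_real[of x] tanh_real_pos_iff[of "artanh x"] by simp

lemma abs_tanh_less_1: "\<bar>tanh x\<bar> < (1::real)"
  using tanh_real_bounds[of x] by auto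

lemma mob_tanh:
  assumes "0 < \<tau>"
  shows "mob (\<tau> * tanh x) \<tau> (\<tau> * tanh y) = \<tau> * tanh (x + y)"
proof -
  have "\<tau> * tanh x * (\<tau> * tanh y) / \<tau>\<^sup>2 = tanh x * tanh y"
    using assms by (simp add: power2_eq_square)
  moreover have "tanh (x + y) = (tanh x + tanh y) / (1 + tanh x * tanh y)"
    by (rule tanh_add) auto
  ultimately show ?thesis
    by (simp add: mob_def algebra_simps)
qed

lemma period_fun_zero_iff:
  assumes "(\<alpha>, \<beta>, \<tau>) \<in> pos_params" "\<alpha> < \<beta>"
  shows "Qfun \<alpha> \<beta> \<tau> = 0 \<longleftrightarrow> period_fun (\<alpha>, \<beta>, \<tau>) = 0"
proof -
  have as: "0 < \<alpha>" "\<alpha> < \<tau>" "0 < \<beta>" "\<beta> < \<tau>" and \<tau>: "0 < \<tau>"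
    using assms by (auto simp: pos_params_def)
  define a b where "a = artanh (\<alpha> / \<tau>)" and "b = artanh (\<beta> / \<tau>)"
  have ta: "tanh a = \<alpha> / \<tau>" and tb: "tanh b = \<beta> / \<tau>"
    using as \<tau> by (simp_all add: a_def b_def tanh_artanh_real less_trans[of "-1" 0])
  have a0: "a > 0" "b > 0" using as \<tau> by (auto simp: a_def b_def intro!: artanh_pos)
  have ab: "a < b" using assms(2) \<tau> ta tb tanh_real_less_iff[of a b] by (simp add: divide_strict_right_mono)
  \<comment> \<open>In the artanh coordinate these are half the sum and half the difference of
    \<open>a\<close> and \<open>b\<close>. Translation by the half difference takes the half sum to
    \<open>b\<close> and its negative to \<open>- a\<close>, that is, to beta and -alpha.\<close>
  define k \<gamma> where "k = \<tau> * tanh ((a + b) / 2)" and "\<gamma> = \<tau> * tanh ((b - a) / 2)"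
  have "mob \<gamma> \<tau> k = \<beta>"
    unfolding k_def \<gamma>_def mob_tanh[OF \<tau>] using tb \<tau> by (simp add: field_simps)
  moreover have "mob \<gamma> \<tau> (- k) = - \<alpha>"
  proof -
    have "- k = \<tau> * tanh (- ((a + b) / 2))" by (simp only: k_def tanh_minus mult_minus_right)
    then have "mob \<gamma> \<tau> (- k) = \<tau> * tanh ((b - a) / 2 + - ((a + b) / 2))"
      by (simp only: \<gamma>_def mob_tanh[OF \<tau>])
    also have "(b - a) / 2 + - ((a + b) / 2) = - a" by (simp add: field_simps)
    finally show ?thesis using ta \<tau> by simp
  qed
  moreover have "0 < k" "k < \<tau>" "0 < \<gamma>" "\<gamma> < \<tau>"
    using \<tau> a0 ab tanh_real_lt_1 by (auto simp: k_def \<gamma>_def)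
  ultimately have "Qfun \<alpha> \<beta> \<tau> = 0 \<longleftrightarrow> period_det k \<gamma> \<tau> = 0"
    using Qfun_zero_iff[of k \<tau> \<gamma>] by simp
  then show ?thesis by (simp add: period_fun_def k_def \<gamma>_def a_def b_def)
qed

lemma period_fun_diag:
  assumes "0 < \<alpha>" "\<alpha> < \<tau>"
  shows "period_fun (\<alpha>, \<alpha>, \<tau>) = period_det \<alpha> 0 \<tau>"
proof -
  have "\<tau> * tanh (artanh (\<alpha> / \<tau>)) = \<alpha>"
    using assms by (subst tanh_artanh_real) (auto simp: less_trans[of "-1" 0])
  then show ?thesis by (simp add: period_fun_def)
qed

lemma continuous_on_period_fun: "continuous_on pos_params period_fun"
proof -
  have "continuous_on pos_params (\<lambda>x. period_det
     (snd (snd x) * tanh ((artanh (fst x / snd (snd x)) + artanh (fst (snd x) / snd (snd x))) / 2))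
     (snd (snd x) * tanh ((artanh (fst (snd x) / snd (snd x)) - artanh (fst x / snd (snd x))) / 2)) (snd (snd x)))"
  proof (rule continuous_on_period_det)
    fix x :: "real \<times> real \<times> real" assume x: "x \<in> pos_params"
    obtain \<alpha> \<beta> \<tau> where x_eq: "x = (\<alpha>, \<beta>, \<tau>)" by (cases x)
    have as: "0 < \<alpha>" "\<alpha> < \<tau>" "0 < \<beta>" "\<beta> < \<tau>" "0 < \<tau>"
      using x by (auto simp: pos_params_def x_eq)
    have "artanh (\<alpha> / \<tau>) > 0" "artanh (\<beta> / \<tau>) > 0" using as by (auto intro!: artanh_pos)
    then show "0 < snd (snd x) * tanh ((artanh (fst x / snd (snd x)) + artanh (fst (snd x) / snd (snd x))) / 2) \<and>
      snd (snd x) * tanh ((artanh (fst x / snd (snd x)) + artanh (fst (snd x) / snd (snd x))) / 2) < snd (snd x) \<and>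
      \<bar>snd (snd x) * tanh ((artanh (fst (snd x) / snd (snd x)) - artanh (fst x / snd (snd x))) / 2)\<bar> < snd (snd x)"
      using as tanh_real_lt_1 abs_tanh_less_1 by (simp add: x_eq abs_mult)
  next
    have s: "0 < fst x" "fst x < snd (snd x)" "0 < fst (snd x)" "fst (snd x) < snd (snd x)" "0 < snd (snd x)"
      if "x \<in> pos_params" for x
      using that by (auto simp: pos_params_def)
    have r: "fst x / snd (snd x) \<in> {-1<..<1}" "fst (snd x) / snd (snd x) \<in> {-1<..<1}"
      if "x \<in> pos_params" for x
      using s[OF that] by (auto simp: less_trans[of "-1" 0])
    have nz: "snd (snd x) \<noteq> 0" if "x \<in> pos_params" for x :: "real \<times> real \<times> real"
      using s[OF that] by simp
    have q: "continuous_on pos_params (\<lambda>x. fst x / snd (snd x))"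
      "continuous_on pos_params (\<lambda>x. fst (snd x) / snd (snd x))"
      using nz by (auto intro!: continuous_on_divide continuous_on_fst continuous_on_snd continuous_on_id)
    have art: "continuous_on {-1<..<1} (artanh :: real \<Rightarrow> real)"
      by (rule continuous_on_artanh) auto
    have A: "continuous_on pos_params (\<lambda>x. artanh (fst x / snd (snd x)))"
      "continuous_on pos_params (\<lambda>x. artanh (fst (snd x) / snd (snd x)))"
      using r by (auto intro!: continuous_on_compose2[OF art q(1)] continuous_on_compose2[OF art q(2)])
    show "continuous_on pos_params
      (\<lambda>x. snd (snd x) * tanh ((artanh (fst x / snd (snd x)) + artanh (fst (snd x) / snd (snd x))) / 2))"
      "continuous_on pos_params
      (\<lambda>x. snd (snd x) * tanh ((artanh (fst (snd x) / snd (snd x)) - artanh (fst x / snd (snd x))) / 2))"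
      "continuous_on pos_params (\<lambda>x. snd (snd x))"
      by (intro continuous_on_mult continuous_on_tanh continuous_on_divide continuous_on_add continuous_on_diff A
          continuous_on_snd continuous_on_id continuous_on_const; simp)+
  qed
  then show ?thesis by (simp add: period_fun_def case_prod_unfold)
qed

section \<open>Elliptic integrals\<close>

lemma ell_modulus_pos:
  fixes m \<theta> :: real
  assumes "m < 1"
  shows "1 - m * (sin \<theta>)\<^sup>2 > 0"
proof (cases "m \<le> 0")
  case True
  then have "m * (sin \<theta>)\<^sup>2 \<le> 0" by (simp add: mult_nonpos_nonneg)
  then show ?thesis by simp
next
  case False
  then have "m * (sin \<theta>)\<^sup>2 \<le> m * 1"
    by (intro mult_left_mono) (auto simp: abs_square_le_1)
  then show ?thesis using assms by simp
qed

lemma continuous_on_ellK_integrand: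
  "m < 1 \<Longrightarrow> continuous_on A (\<lambda>\<theta>::real. 1 / sqrt (1 - m * (sin \<theta>)\<^sup>2))"
  using ell_modulus_pos[of m] by (intro continuous_intros) (auto simp: less_imp_neq[symmetric])

lemma continuous_on_ellE_integrand:
  "continuous_on A (\<lambda>\<theta>::real. sqrt (1 - m * (sin \<theta>)\<^sup>2))"
  by (intro continuous_intros)

lemma ellK_pos:
  assumes "m < 1"
  shows "ellK m > 0"
proof -
  have "integral {0..pi/2} (\<lambda>_. 0) < ellK m"
    unfolding ellK_def using ell_modulus_pos[OF assms]
    by (intro integral_less_real continuous_on_ellK_integrand assms continuous_on_const)
      (use pi_gt_zero in \<open>auto simp: not_le\<close>)
  then show ?thesis by simp
qed

lemma ellK_mono:
  assumes "m \<le> m'" "m' < 1"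
  shows "ellK m \<le> ellK m'"
  unfolding ellK_def
proof (rule integral_le)
  show "(\<lambda>\<theta>. 1 / sqrt (1 - m * (sin \<theta>)\<^sup>2)) integrable_on {0..pi/2}"
    "(\<lambda>\<theta>. 1 / sqrt (1 - m' * (sin \<theta>)\<^sup>2)) integrable_on {0..pi/2}"
    using assms by (auto intro!: integrable_continuous_real continuous_on_ellK_integrand)
  fix \<theta> :: real
  have "m * (sin \<theta>)\<^sup>2 \<le> m' * (sin \<theta>)\<^sup>2" using assms by (intro mult_right_mono) auto
  then show "1 / sqrt (1 - m * (sin \<theta>)\<^sup>2) \<le> 1 / sqrt (1 - m' * (sin \<theta>)\<^sup>2)"
    using ell_modulus_pos[OF assms(2), of \<theta>] by (intro divide_left_mono) auto
qed

lemma ellE_strict_antimono: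
  assumes "m < m'"
  shows "ellE m' < ellE m"
  unfolding ellE_def
proof (rule integral_less_real[OF continuous_on_ellE_integrand continuous_on_ellE_integrand])
  show "{0<..<pi/2} \<noteq> {}" using pi_gt_zero by (auto simp: not_le)
  fix \<theta> assume "\<theta> \<in> {0<..<pi/2}"
  then have "sin \<theta> > 0" by (intro sin_gt_zero) auto
  then have "m * (sin \<theta>)\<^sup>2 < m' * (sin \<theta>)\<^sup>2" using assms by (intro mult_strict_right_mono) auto
  then show "sqrt (1 - m' * (sin \<theta>)\<^sup>2) < sqrt (1 - m * (sin \<theta>)\<^sup>2)" by simp
qed

text \<open>With r the square root in the integrand, (1 - r^2) / r = 1 / r - r pointwise. This is
  the integral produced by the factor z^2 in the inner part of \<open>period_det\<close>.\<close>

lemma ellK_minus_ellE: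
  assumes "m < 1"
  shows "integral {0..pi/2} (\<lambda>\<theta>. m * (sin \<theta>)\<^sup>2 / sqrt (1 - m * (sin \<theta>)\<^sup>2)) = ellK m - ellE m"
proof -
  have "integral {0..pi/2} (\<lambda>\<theta>. m * (sin \<theta>)\<^sup>2 / sqrt (1 - m * (sin \<theta>)\<^sup>2))
     = integral {0..pi/2} (\<lambda>\<theta>. 1 / sqrt (1 - m * (sin \<theta>)\<^sup>2) - sqrt (1 - m * (sin \<theta>)\<^sup>2))"
  proof (rule integral_cong)
    fix \<theta> :: real
    have "1 - m * (sin \<theta>)\<^sup>2 > 0" by (rule ell_modulus_pos[OF assms])
    then have "sqrt (1 - m * (sin \<theta>)\<^sup>2) = (1 - m * (sin \<theta>)\<^sup>2) / sqrt (1 - m * (sin \<theta>)\<^sup>2)"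
      by (simp add: real_div_sqrt)
    then show "m * (sin \<theta>)\<^sup>2 / sqrt (1 - m * (sin \<theta>)\<^sup>2) = 1 / sqrt (1 - m * (sin \<theta>)\<^sup>2) - sqrt (1 - m * (sin \<theta>)\<^sup>2)"
      by (simp add: diff_divide_distrib)
  qed
  also have "\<dots> = ellK m - ellE m"
    unfolding ellK_def ellE_def
    by (intro integral_diff integrable_continuous_real continuous_on_ellK_integrand continuous_on_ellE_integrand assms)
  finally show ?thesis .
qed

lemma ellE_le_ellK:
  assumes "0 \<le> m" "m < 1"
  shows "ellE m \<le> ellK m"
proof -
  have "0 \<le> integral {0..pi/2} (\<lambda>\<theta>. m * (sin \<theta>)\<^sup>2 / sqrt (1 - m * (sin \<theta>)\<^sup>2))"
    using assms ell_modulus_pos[OF assms(2)]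
    by (intro integral_nonneg integrable_continuous_real)
      (auto intro!: continuous_intros divide_nonneg_nonneg simp: less_imp_neq[symmetric] less_imp_le)
  then show ?thesis using ellK_minus_ellE[OF assms(2)] by simp
qed

definition ell_fun :: "real \<Rightarrow> real \<Rightarrow> real" where
  "ell_fun m1 m2 = ellKbar m1 * ellE m2 + m2 * ellEbar m1 * ellK m2 - ellKbar m1 * ellK m2"

text \<open>Write the function as m2 Ebar(m1) K(m2) - Kbar(m1) (K(m2) - E(m2)). The complementary
  modulus 1 - m1 decreases, so Ebar grows strictly and Kbar does not grow; since K(m2) - E(m2) is
  nonnegative, the first term already gives strictness.\<close>

lemma ell_fun_strict_mono:
  assumes "0 < m" "m < m'" "0 < m2" "m2 < 1"
  shows "ell_fun m m2 < ell_fun m' m2"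
proof -
  have K: "ellKbar m' \<le> ellKbar m" unfolding ellKbar_def using assms by (intro ellK_mono) auto
  have E: "ellEbar m < ellEbar m'" unfolding ellEbar_def using assms by (intro ellE_strict_antimono) auto
  have "m2 * ellK m2 > 0" using assms ellK_pos by simp
  then have 1: "m2 * ellK m2 * ellEbar m < m2 * ellK m2 * ellEbar m'" using E by (intro mult_strict_left_mono)
  have "(ellKbar m - ellKbar m') * (ellK m2 - ellE m2) \<ge> 0"
    using K ellE_le_ellK[of m2] assms by simp
  then show ?thesis using 1 by (simp add: ell_fun_def algebra_simps)
qed

text \<open>At gamma = 0 \<open>qf\<close> is z^2 + 4, so \<open>Psum\<close> is the constant 2 and
  \<open>Rdiff\<close> is 1 / (2 (z^2 + 4)). On the outer side 1 / (z^2 + 4) is a multiple of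
  \<open>Lout\<close>, which turns 1 / sqrt into sqrt and K into E; on the inner side z^2 / (z^2 +
  4) is a multiple of the squared sine, which gives K - E.\<close>

lemma period_det_0:
  assumes k: "0 < k" "k < \<tau>"
  defines "m1 \<equiv> (k\<^sup>2 + 4) / (\<tau>\<^sup>2 + 4)"
      and "m2 \<equiv> (k\<^sup>2 / \<tau>\<^sup>2) * ((\<tau>\<^sup>2 + 4) / (k\<^sup>2 + 4))"
  shows "\<exists>c>0. period_det k 0 \<tau> = - c * ell_fun m1 m2" "0 < m1" "m1 < 1" "0 < m2" "m2 < 1"
proof -
  have \<tau>: "\<tau> > 0" using k by simp
  have kt: "k\<^sup>2 < \<tau>\<^sup>2" using k by (simp add: power_strict_mono)
  have A4: "k\<^sup>2 + 4 > 0" "\<tau>\<^sup>2 + 4 > 0" by (auto intro: add_nonneg_pos)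
  show m1: "0 < m1" "m1 < 1" using A4 kt by (auto simp: m1_def)
  show m2: "0 < m2" using A4 k by (simp add: m2_def)
  have "k\<^sup>2 * (\<tau>\<^sup>2 + 4) < \<tau>\<^sup>2 * (k\<^sup>2 + 4)" using kt by (simp add: algebra_simps)
  then show m2': "m2 < 1" using A4 \<tau> by (simp add: m2_def divide_simps mult.commute)
  have L: "sqrt (Lout k \<tau> \<theta>) = sqrt (\<tau>\<^sup>2 + 4) * sqrt (1 - (1 - m1) * (sin \<theta>)\<^sup>2)" for \<theta>
  proof -
    have "(\<tau>\<^sup>2 + 4) * (1 - (1 - m1) * (sin \<theta>)\<^sup>2) = (\<tau>\<^sup>2 + 4) * (1 - (sin \<theta>)\<^sup>2) + ((\<tau>\<^sup>2 + 4) * m1) * (sin \<theta>)\<^sup>2"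
      by (simp add: algebra_simps)
    also have "(\<tau>\<^sup>2 + 4) * m1 = k\<^sup>2 + 4" using A4 by (simp add: m1_def)
    finally show ?thesis by (simp add: Lout_def cos_squared_eq real_sqrt_mult[symmetric])
  qed
  have N: "sqrt (Nin k \<tau> \<theta>) = sqrt (\<tau>\<^sup>2 * (k\<^sup>2 + 4)) * sqrt (1 - m2 * (sin \<theta>)\<^sup>2)" for \<theta>
  proof -
    have "\<tau>\<^sup>2 * (k\<^sup>2 + 4) * (1 - m2 * (sin \<theta>)\<^sup>2) = \<tau>\<^sup>2 * (k\<^sup>2 + 4) - (\<tau>\<^sup>2 * (k\<^sup>2 + 4) * m2) * (sin \<theta>)\<^sup>2"
      by (simp add: algebra_simps)
    also have "\<tau>\<^sup>2 * (k\<^sup>2 + 4) * m2 = k\<^sup>2 * (\<tau>\<^sup>2 + 4)" using A4 \<tau> by (simp add: m2_def)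
    finally show ?thesis by (simp add: Nin_def real_sqrt_mult[symmetric])
  qed
  have w: "z\<^sup>2 + 4 > 0" for z :: real by (auto intro: add_nonneg_pos)
  have P: "Psum 0 \<tau> = (\<lambda>z. 2)"
    using w by (simp add: fun_eq_iff Psum_def qf_def less_imp_neq[symmetric])
  have R: "Rdiff 0 \<tau> z = 1 / (2 * (z\<^sup>2 + 4))" for z
    using w[of z] by (simp add: Rdiff_def qf_def less_imp_neq[symmetric])
  have Mo: "outer_int k \<tau> (Psum 0 \<tau>) = 2 / sqrt (\<tau>\<^sup>2 + 4) * ellKbar m1"
  proof -
    have "outer_int k \<tau> (Psum 0 \<tau>) = integral {0..pi/2}
      (\<lambda>\<theta>. 2 / sqrt (\<tau>\<^sup>2 + 4) * (1 / sqrt (1 - (1 - m1) * (sin \<theta>)\<^sup>2)))"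
      by (simp add: outer_int_def P L)
    then show ?thesis by (simp only: integral_mult_right ellKbar_def ellK_def)
  qed
  have Ni: "inner_int k \<tau> (Psum 0 \<tau>) = 2 / sqrt (\<tau>\<^sup>2 * (k\<^sup>2 + 4)) * ellK m2"
  proof -
    have "inner_int k \<tau> (Psum 0 \<tau>) = integral {0..pi/2}
      (\<lambda>\<theta>. 2 / sqrt (\<tau>\<^sup>2 * (k\<^sup>2 + 4)) * (1 / sqrt (1 - m2 * (sin \<theta>)\<^sup>2)))"
      by (simp only: inner_int_def P N) simp
    then show ?thesis by (simp only: integral_mult_right ellK_def)
  qed
  have V: "outer_int k \<tau> (Rdiff 0 \<tau>) = 1 / (2 * (k\<^sup>2 + 4) * sqrt (\<tau>\<^sup>2 + 4)) * ellEbar m1"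
  proof -
    have "Rdiff 0 \<tau> (zout k \<tau> \<theta>) / sqrt (Lout k \<tau> \<theta>)
        = 1 / (2 * (k\<^sup>2 + 4) * sqrt (\<tau>\<^sup>2 + 4)) * sqrt (1 - (1 - m1) * (sin \<theta>)\<^sup>2)" for \<theta>
    proof -
      have "Rdiff 0 \<tau> (zout k \<tau> \<theta>) / sqrt (Lout k \<tau> \<theta>)
        = Lout k \<tau> \<theta> / sqrt (Lout k \<tau> \<theta>) / (2 * ((k\<^sup>2 + 4) * (\<tau>\<^sup>2 + 4)))"
        unfolding R zout_identities by simp
      also have "Lout k \<tau> \<theta> / sqrt (Lout k \<tau> \<theta>) = sqrt (\<tau>\<^sup>2 + 4) * sqrt (1 - (1 - m1) * (sin \<theta>)\<^sup>2)"
        unfolding L[symmetric] using Lout_pos[of k \<tau> \<theta>] by (simp add: real_div_sqrt)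
      also have "sqrt (\<tau>\<^sup>2 + 4) * sqrt (1 - (1 - m1) * (sin \<theta>)\<^sup>2) / (2 * ((k\<^sup>2 + 4) * (\<tau>\<^sup>2 + 4)))
        = (sqrt (\<tau>\<^sup>2 + 4) / (\<tau>\<^sup>2 + 4)) * (sqrt (1 - (1 - m1) * (sin \<theta>)\<^sup>2) / (2 * (k\<^sup>2 + 4)))"
        by simp
      also have "sqrt (\<tau>\<^sup>2 + 4) / (\<tau>\<^sup>2 + 4) = 1 / sqrt (\<tau>\<^sup>2 + 4)"
        using A4 by (simp add: sqrt_divide_self_eq inverse_eq_divide)
      finally show ?thesis by simp
    qed
    then show ?thesis by (simp only: outer_int_def integral_mult_right ellEbar_def ellE_def)
  qed
  have U: "inner_int k \<tau> (\<lambda>z. z\<^sup>2 * Rdiff 0 \<tau> z)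
      = k\<^sup>2 / (2 * (k\<^sup>2 + 4) * m2 * sqrt (\<tau>\<^sup>2 * (k\<^sup>2 + 4))) * (ellK m2 - ellE m2)"
  proof -
    have "(zin k \<theta>)\<^sup>2 * Rdiff 0 \<tau> (zin k \<theta>) / sqrt (Nin k \<tau> \<theta>)
       = k\<^sup>2 / (2 * (k\<^sup>2 + 4) * m2 * sqrt (\<tau>\<^sup>2 * (k\<^sup>2 + 4))) * (m2 * (sin \<theta>)\<^sup>2 / sqrt (1 - m2 * (sin \<theta>)\<^sup>2))" for \<theta>
    proof -
      have "(zin k \<theta>)\<^sup>2 * Rdiff 0 \<tau> (zin k \<theta>) = k\<^sup>2 * (sin \<theta>)\<^sup>2 / (2 * (k\<^sup>2 + 4))"
      proof -
        have "4 * x * y / l * (1 / (2 * (4 * n / l))) = x * y / (2 * n)" if "l > 0" "n > 0" for x y l n :: real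
          using that by (simp add: field_simps)
        then show ?thesis
          unfolding R zin_identities unfolding zin_sq using zin_den_pos A4 by blast
      qed
      then show ?thesis unfolding N using m2 by simp
    qed
    then show ?thesis
      by (simp only: inner_int_def integral_mult_right ellK_minus_ellE[OF m2'])
  qed
  define c where "c = \<tau>\<^sup>2 / (\<tau>\<^sup>2 + 4) / (sqrt (\<tau>\<^sup>2 + 4) * sqrt (\<tau>\<^sup>2 * (k\<^sup>2 + 4)))"
  have "c > 0" using A4 \<tau> by (simp add: c_def)
  moreover have "period_det k 0 \<tau> = - c * ell_fun m1 m2"
  proof -
    \<comment> \<open>The coefficients of the two products differ exactly by the factor m2, the one
      that stands in the criterion; what they share goes into \<open>c\<close>.\<close>
    have e1: "k\<^sup>2 / ((k\<^sup>2 + 4) * m2) = \<tau>\<^sup>2 / (\<tau>\<^sup>2 + 4)"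
      using A4 k \<tau> by (simp add: m2_def)
    have e2: "k\<^sup>2 / (k\<^sup>2 + 4) = \<tau>\<^sup>2 / (\<tau>\<^sup>2 + 4) * m2"
      using A4 k \<tau> by (simp add: m2_def)
    have "period_det k 0 \<tau> = ((k\<^sup>2 / ((k\<^sup>2 + 4) * m2)) * (ellKbar m1 * (ellK m2 - ellE m2))
        - (k\<^sup>2 / (k\<^sup>2 + 4)) * (ellK m2 * ellEbar m1)) / (sqrt (\<tau>\<^sup>2 + 4) * sqrt (\<tau>\<^sup>2 * (k\<^sup>2 + 4)))"
    proof -
      have "2 / p * K1 * (x / (2 * n * m * q) * D) - x * (2 / q * K2) * (1 / (2 * n * p) * E1)
          = (x / (n * m) * (K1 * D) - x / n * (K2 * E1)) / (p * q)" for p q x n m K1 K2 D E1 :: real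
        by (simp add: diff_divide_distrib mult_ac)
      then show ?thesis unfolding period_det_def Mo Ni U V by blast
    qed
    also have "\<dots> = - c * ell_fun m1 m2"
      unfolding e1 e2 c_def ell_fun_def
      by (simp add: diff_divide_distrib add_divide_distrib algebra_simps)
    finally show ?thesis .
  qed
  ultimately show "\<exists>c>0. period_det k 0 \<tau> = - c * ell_fun m1 m2" by blast
qed

section \<open>The closure of the parameter set\<close>

lemma open_pos_params: "open pos_params"
  unfolding pos_params_def case_prod_unfold
  by (intro open_Collect_conj open_Collect_less continuous_intros)

text \<open>The formulas solve for a and t with given moduli: the product m1 m2 is a^2 / t^2, and
  inserting this into a^2 + 4 = m1 (t^2 + 4) leaves a linear equation for t^2.\<close>

lemma modulus_path:
  fixes m1 m2 :: real
  assumes "0 < m1" "m1 < 1" "0 < m2" "m2 < 1"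
  defines "t \<equiv> sqrt (4 * (1 - m1) / (m1 * (1 - m2)))"
  defines "a \<equiv> sqrt (m1 * m2) * t"
  shows "0 < a" "a < t" "(a\<^sup>2 + 4) / (t\<^sup>2 + 4) = m1" "(a\<^sup>2 / t\<^sup>2) * ((t\<^sup>2 + 4) / (a\<^sup>2 + 4)) = m2"
proof -
  have t2: "t\<^sup>2 = 4 * (1 - m1) / (m1 * (1 - m2))" using assms by (simp add: t_def)
  have t: "t > 0" using assms by (simp add: t_def)
  have a2: "a\<^sup>2 = m1 * m2 * t\<^sup>2" using assms by (simp add: a_def power_mult_distrib)
  show "0 < a" using assms t by (simp add: a_def)
  have "m1 * m2 < 1" using assms by (smt (verit) mult_less_cancel_left1)
  then have "sqrt (m1 * m2) < 1" by simp
  then show "a < t" using t by (simp add: a_def)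
  have e: "a\<^sup>2 + 4 = m1 * (t\<^sup>2 + 4)"
    unfolding a2 unfolding t2 using assms by (simp add: field_simps)
  have t4: "t\<^sup>2 + 4 > 0" by (auto intro: add_nonneg_pos)
  show "(a\<^sup>2 + 4) / (t\<^sup>2 + 4) = m1" unfolding e using t4 by simp
  show "(a\<^sup>2 / t\<^sup>2) * ((t\<^sup>2 + 4) / (a\<^sup>2 + 4)) = m2"
    unfolding e unfolding a2 using t4 t assms by simp
qed

text \<open>Ensures that the path with fixed m2 passes through the given alpha and tau at parameter
  m1.\<close>

lemma modulus_path_inverse:
  fixes \<alpha> \<tau> :: real
  assumes "0 < \<alpha>" "\<alpha> < \<tau>"
  defines "m1 \<equiv> (\<alpha>\<^sup>2 + 4) / (\<tau>\<^sup>2 + 4)"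
      and "m2 \<equiv> (\<alpha>\<^sup>2 / \<tau>\<^sup>2) * ((\<tau>\<^sup>2 + 4) / (\<alpha>\<^sup>2 + 4))"
  shows "sqrt (4 * (1 - m1) / (m1 * (1 - m2))) = \<tau>" "sqrt (m1 * m2) * \<tau> = \<alpha>"
proof -
  have \<tau>: "\<tau> > 0" using assms by simp
  have A4: "\<alpha>\<^sup>2 + 4 > 0" "\<tau>\<^sup>2 + 4 > 0" by (auto intro: add_nonneg_pos)
  have at: "\<alpha>\<^sup>2 < \<tau>\<^sup>2" using assms by (simp add: power_strict_mono)
  have mm: "m1 * m2 = \<alpha>\<^sup>2 / \<tau>\<^sup>2" using A4 by (simp add: m1_def m2_def)
  then show "sqrt (m1 * m2) * \<tau> = \<alpha>" using assms \<tau> by (simp add: real_sqrt_divide)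
  have n: "1 - m1 = (\<tau>\<^sup>2 - \<alpha>\<^sup>2) / (\<tau>\<^sup>2 + 4)"
    using A4 by (simp add: m1_def field_simps)
  have d: "m1 * (1 - m2) = 4 * (\<tau>\<^sup>2 - \<alpha>\<^sup>2) / (\<tau>\<^sup>2 + 4) / \<tau>\<^sup>2"
    using A4 \<tau> unfolding right_diff_distrib mm by (simp add: m1_def field_simps)
  have "4 * (1 - m1) / (m1 * (1 - m2)) = \<tau>\<^sup>2"
    unfolding n d using at A4 \<tau> by simp
  then show "sqrt (4 * (1 - m1) / (m1 * (1 - m2))) = \<tau>" using \<tau> by simp
qed

lemma oH_params_iff_period_fun_zero:
  assumes "(\<alpha>, \<beta>, \<tau>) \<in> pos_params" "\<alpha> < \<beta>"
  shows "(\<alpha>, \<beta>, \<tau>) \<in> oH_params \<longleftrightarrow> period_fun (\<alpha>, \<beta>, \<tau>) = 0"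
  using assms period_fun_zero_iff[OF assms] by (auto simp: oH_params_def pos_params_def)

theorem mainTheorem9:
  fixes \<alpha> \<tau> :: real
  assumes "0 < \<alpha>" and "\<alpha> < \<tau>"
  defines "m1 \<equiv> (\<alpha>\<^sup>2 + 4) / (\<tau>\<^sup>2 + 4)"
      and "m2 \<equiv> (\<alpha>\<^sup>2 / \<tau>\<^sup>2) * ((\<tau>\<^sup>2 + 4) / (\<alpha>\<^sup>2 + 4))"
  shows "(\<alpha>, \<alpha>, \<tau>) \<in> closure oH_params \<longleftrightarrow>
         ellKbar m1 * ellE m2 + m2 * ellEbar m1 * ellK m2 = ellKbar m1 * ellK m2"
proof -
  let ?x = "(\<alpha>, \<alpha>, \<tau>)"
  have x: "?x \<in> pos_params" using assms(1,2) by (simp add: pos_params_def)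
  note m = period_det_0(2-5)[OF assms(1,2), folded m1_def m2_def]
  have diag: "period_fun ?x = 0 \<longleftrightarrow> ell_fun m1 m2 = 0"
    using period_det_0(1)[OF assms(1,2), folded m1_def m2_def] period_fun_diag[OF assms(1,2)] by auto
  have open_pre: "open (pos_params \<inter> period_fun -` S)" if "open S" for S
    by (rule continuous_open_preimage[OF continuous_on_period_fun open_pos_params that])
  have "?x \<in> closure oH_params \<longleftrightarrow> ell_fun m1 m2 = 0"
  proof
    assume cl: "?x \<in> closure oH_params"
    show "ell_fun m1 m2 = 0"
    proof (rule ccontr)
      assume "ell_fun m1 m2 \<noteq> 0"
      \<comment> \<open>The points of \<open>pos_params\<close> where \<open>period_fun\<close> does
        not vanish form an open neighbourhood of the diagonal point, hence one that meets
        \<open>oH_params\<close>; but there alpha < beta forces a zero.\<close>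
      then have "?x \<in> pos_params \<inter> period_fun -` (- {0})" using x diag by simp
      then have "(pos_params \<inter> period_fun -` (- {0})) \<inter> oH_params \<noteq> {}"
        using cl open_Int_closure_eq_empty[OF open_pre[of "- {0}"]] by blast
      then obtain y where y: "y \<in> oH_params" "y \<in> pos_params" "period_fun y \<noteq> 0" by blast
      obtain a b t where y_eq: "y = (a, b, t)" by (cases y)
      then have "a < b" using y(1) by (simp add: oH_params_def)
      then show False using y oH_params_iff_period_fun_zero[of a b t] by (simp add: y_eq)
    qed
  next
    assume zero: "ell_fun m1 m2 = 0"
    \<comment> \<open>The curve of diagonal points whose moduli are s and the fixed m2.\<close>
    define t where "t s = sqrt (4 * (1 - s) / (s * (1 - m2)))" for s
    define a where "a s = sqrt (s * m2) * t s" for s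
    have path: "0 < a s" "a s < t s" and
      sgn: "\<exists>c>0. period_fun (a s, a s, t s) = - c * ell_fun s m2" if "0 < s" "s < 1" for s
    proof -
      note p = modulus_path[OF that m(3,4), folded t_def, folded a_def]
      show "0 < a s" "a s < t s" by (fact p)+
      show "\<exists>c>0. period_fun (a s, a s, t s) = - c * ell_fun s m2"
        using period_det_0(1)[OF p(1,2)] p(3,4) period_fun_diag[OF p(1,2)] by simp
    qed
    have x_eq: "t m1 = \<tau>" "a m1 = \<alpha>"
      using modulus_path_inverse[OF assms(1,2)] by (simp_all add: m1_def m2_def a_def t_def)
    have cont_t: "continuous_on {0<..<1} t" and cont_a: "continuous_on {0<..<1} a"
      unfolding t_def[abs_def] a_def[abs_def] using m by (auto intro!: continuous_intros)
    show "?x \<in> closure oH_params"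
      unfolding closure_approachable
    proof (intro allI impI)
      fix e :: real assume e: "e > 0"
      have "open (pos_params \<inter> ball ?x e)" "?x \<in> pos_params \<inter> ball ?x e"
        using open_pos_params x e by auto
      \<comment> \<open>The radius \<open>d\<close> is spent in two halves: one for moving along the
        curve, the other for shifting beta off the diagonal.\<close>
      then obtain d where d: "d > 0" "ball ?x d \<subseteq> pos_params \<inter> ball ?x e"
        using openE by blast
      have "isCont (\<lambda>s. (a s, a s, t s)) m1"
        using cont_a cont_t m by (auto intro!: continuous_intros simp: continuous_on_eq_continuous_at)
      then obtain \<eta> where \<eta>: "\<eta> > 0"
        "\<And>s. \<bar>s - m1\<bar> < \<eta> \<Longrightarrow> dist (a s, a s, t s) ?x < d / 2"
        using d(1) by (force simp: continuous_at_eps_delta x_eq dist_real_def dest: spec[of _ "d/2"])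
      define \<delta> where "\<delta> = Min {\<eta>, m1, 1 - m1} / 2"
      have \<delta>: "0 < \<delta>" "\<delta> < \<eta>" "\<delta> < m1" "\<delta> < 1 - m1"
        using \<eta>(1) m by (auto simp: \<delta>_def min_def)
      define u v where "u = m1 - \<delta>" and "v = m1 + \<delta>"
      have uv: "0 < u" "u < m1" "m1 < v" "v < 1" using \<delta> by (auto simp: u_def v_def)
      have near: "dist (a s, a s, t s) ?x < d / 2" "0 < s" "s < 1" if "u \<le> s" "s \<le> v" for s
        using that \<delta> \<eta>(2)[of s] by (auto simp: u_def v_def abs_less_iff)
      have in_pos: "(a s, a s, t s) \<in> pos_params" if "u \<le> s" "s \<le> v" for s
        using path[of s] near[OF that] by (simp add: pos_params_def)
      have "ell_fun u m2 < 0" "0 < ell_fun v m2"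
        using ell_fun_strict_mono[of u m1 m2] ell_fun_strict_mono[of m1 v m2] uv m zero by auto
      \<comment> \<open>The factor \<open>- c\<close> reverses the sign, so
        \<open>period_fun\<close> falls from \<open>u\<close> to \<open>v\<close> although
        \<open>ell_fun\<close> rises.\<close>
      then have "period_fun (a u, a u, t u) > 0" "period_fun (a v, a v, t v) < 0"
        using sgn[of u] sgn[of v] uv by (auto simp: mult_pos_neg)
      then have "(a u, a u, t u) \<in> pos_params \<inter> period_fun -` {0<..}"
          "(a v, a v, t v) \<in> pos_params \<inter> period_fun -` {..<0}"
        using in_pos uv by auto
      then obtain r r' where r: "r > 0" "ball (a u, a u, t u) r \<subseteq> period_fun -` {0<..}"
          "r' > 0" "ball (a v, a v, t v) r' \<subseteq> period_fun -` {..<0}"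
        using openE[OF open_pre[of "{0<..}"]] openE[OF open_pre[of "{..<0}"]] by (metis Int_subset_iff open_greaterThan open_lessThan)
      \<comment> \<open>One shift for the whole curve: small enough to preserve the signs at both
        ends and to fit into the second half of \<open>d\<close>, and positive so that alpha < beta
        holds along the shifted curve.\<close>
      define \<epsilon> where "\<epsilon> = Min {r, r', d / 2} / 2"
      have \<epsilon>: "0 < \<epsilon>" "\<epsilon> < r" "\<epsilon> < r'" "\<epsilon> < d / 2"
        using r d by (auto simp: \<epsilon>_def min_def)
      have shift: "dist (a s, a s, t s) (a s, a s + \<epsilon>, t s) = \<epsilon>" for s
        using \<epsilon> by (simp add: dist_Pair_Pair dist_real_def)
      have close: "(a s, a s + \<epsilon>, t s) \<in> ball ?x d" if "u \<le> s" "s \<le> v" for s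
      proof -
        have "dist ?x (a s, a s + \<epsilon>, t s) \<le> dist (a s, a s, t s) ?x + dist (a s, a s, t s) (a s, a s + \<epsilon>, t s)"
          by (metis dist_commute dist_triangle)
        then show ?thesis using near(1)[OF that] \<epsilon> shift[of s] by simp
      qed
      have "(a u, a u + \<epsilon>, t u) \<in> ball (a u, a u, t u) r" "(a v, a v + \<epsilon>, t v) \<in> ball (a v, a v, t v) r'"
        using shift \<epsilon> by auto
      then have "period_fun (a v, a v + \<epsilon>, t v) \<le> 0" "0 \<le> period_fun (a u, a u + \<epsilon>, t u)"
        using r(2,4) by auto
      moreover have "continuous_on {u..v} (\<lambda>s. period_fun (a s, a s + \<epsilon>, t s))"
      proof (rule continuous_on_compose2[OF continuous_on_period_fun])
        have "continuous_on {u..v} a" "continuous_on {u..v} t"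
          using cont_a cont_t uv by (auto intro: continuous_on_subset)
        then show "continuous_on {u..v} (\<lambda>s. (a s, a s + \<epsilon>, t s))"
          by (intro continuous_intros)
        show "(\<lambda>s. (a s, a s + \<epsilon>, t s)) ` {u..v} \<subseteq> pos_params"
          using close d(2) by auto
      qed
      ultimately obtain s where s: "u \<le> s" "s \<le> v" "period_fun (a s, a s + \<epsilon>, t s) = 0"
        using IVT2'[of "\<lambda>s. period_fun (a s, a s + \<epsilon>, t s)" v 0 u] uv by auto
      have "(a s, a s + \<epsilon>, t s) \<in> oH_params"
        using close[OF s(1,2)] d(2) s(3) \<epsilon> oH_params_iff_period_fun_zero[of "a s" "a s + \<epsilon>" "t s"] by auto
      moreover have "dist (a s, a s + \<epsilon>, t s) ?x < e"
      proof -
        have "(a s, a s + \<epsilon>, t s) \<in> ball ?x e" using close[OF s(1,2)] d(2) by blast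
        then show ?thesis by (simp add: dist_commute)
      qed
      ultimately show "\<exists>y\<in>oH_params. dist y ?x < e" by blast
    qed
  qed
  then show ?thesis by (simp add: ell_fun_def)
qed

end
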